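(* For all Banach spaces $X_1,\dots,X_n,Y$ over the same field $\mathbb K$, $$\|Id:\Pi_2^{Lip}(X_1,\dots,X_n;Y)\to\Gamma(X_1,\dots,X_n;Y)\|\le1;$$ that is, every Lipschitz $2$-summing multilinear operator $T:X_1\times\dots\times X_n\to Y$ factors through a Hilbert space and $\Gamma(T)\le\pi_2^{Lip}(T)$.
   Context: $\mathbb K$ is $\mathbb R$ or $\mathbb C$, and $\mathcal L(X_1,\dots,X_n)$ is the Banach space of bounded multilinear forms on $X_1\times\dots\times X_n$ with the norm $\|\varphi\|=\sup\{|\varphi(x^1,\dots,x^n)|:\|x^i\|\le 1\}$. A bounded multilinear operator $T:X_1\times\dots\times X_n\to Y$ is Lipschitz $2$-summing if there is a constant $C\ge0$ such that for all $m$ and all finite sequences $(u_i)_{i=1}^m$, $(v_i)_{i=1}^m$ in $X_1\times\dots\times X_n$, $$\Big(\sum_{i=1}^m\|T(u_i)-T(v_i)\|^2\Big)^{1/2}\le C\,\sup\Big\{\Big(\sum_{i=1}^m|\varphi(u_i)-\varphi(v_i)|^2\Big)^{1/2}:\varphi\in\mathcal L(X_1,\dots,X_n),\ \|\varphi\|\le1\Big\}.$$ $\pi_2^{Lip}(T)$ is the least such $C$, and $\Pi_2^{Lip}(X_1,\dots,X_n;Y)$ is the space of all such $T$ with the norm $\pi_2^{Lip}$. A multilinear operator $T:X_1\times\dots\times X_n\to Y$ factors through a Hilbert space if there exist a Hilbert space $H$, a subset $M\subset H$, a bounded multilinear operator $A:X_1\times\dots\times X_n\to H$ with $A(X_1\times\dots\times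 X_n)\subset M$, and a Lipschitz function $B:M\to Y$ such that $T=B\circ A$. Then $\Gamma(T)=\inf\|A\|\,\mathrm{Lip}(B)$, the infimum over all such factorizations; here $\|A\|=\sup\{\|A(x^1,\dots,x^n)\|:\|x^i\|\le1\}$ and $\mathrm{Lip}(B)$ is the least Lipschitz constant. $\Gamma(X_1,\dots,X_n;Y)$ is the collection of all such $T$, with the norm $\Gamma(\cdot)$. *)

theory Defs
  imports "HOL-Analysis.Analysis" "HOL-Algebra.Module"
begin

text \<open>
  The base field is a set \<^term>\<open>K :: complex set\<close>, meant to be \<^term>\<open>\<real>\<close> or \<^term>\<open>UNIV\<close>. Spaces are
  carrier-based, so that a family of different spaces can be indexed by a natural number and so
  that spaces can be quantified existentially. The fields \<^const>\<open>mult\<close> and \<^const>\<open>one\<close> that modules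
  inherit from rings carry no meaning for spaces.
\<close>

record 'a nspace = "(complex, 'a) module" +
  vnorm :: "'a \<Rightarrow> real"

definition scalars :: "complex set \<Rightarrow> complex nspace" where
  "scalars K = \<lparr>carrier = K, mult = (*), one = 1, zero = 0, add = (+), smult = (*), vnorm = cmod\<rparr>"

locale normed_space = Module.module "scalars K" X
  for K :: "complex set" and X :: "('a, 'm) nspace_scheme" (structure) +
  assumes vnorm_nonneg: "x \<in> carrier X \<Longrightarrow> 0 \<le> vnorm X x"
    and vnorm_eq_0_iff: "x \<in> carrier X \<Longrightarrow> vnorm X x = 0 \<longleftrightarrow> x = \<zero>\<^bsub>X\<^esub>"
    and vnorm_triangle: "x \<in> carrier X \<Longrightarrow> y \<in> carrier X \<Longrightarrow>
           vnorm X (x \<oplus>\<^bsub>X\<^esub> y) \<le> vnorm X x + vnorm X y"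
    and vnorm_smult: "c \<in> K \<Longrightarrow> x \<in> carrier X \<Longrightarrow> vnorm X (c \<odot>\<^bsub>X\<^esub> x) = cmod c * vnorm X x"

text \<open>Off the carrier the distance is set to 0, as \<^locale>\<open>Metric_space\<close> wants it total.\<close>

definition vdist :: "('a, 'm) nspace_scheme \<Rightarrow> 'a \<Rightarrow> 'a \<Rightarrow> real" where
  "vdist X x y = (if x \<in> carrier X \<and> y \<in> carrier X then vnorm X (x \<ominus>\<^bsub>X\<^esub> y) else 0)"

context normed_space
begin

lemma vnorm_zero: "vnorm X \<zero>\<^bsub>X\<^esub> = 0"
  using vnorm_eq_0_iff[of "\<zero>\<^bsub>X\<^esub>"] by simp

lemma vnorm_uminus: "x \<in> carrier X \<Longrightarrow> vnorm X (\<ominus>\<^bsub>X\<^esub> x) = vnorm X x"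
proof -
  assume x: "x \<in> carrier X"
  have one: "(1::complex) \<in> carrier (scalars K)"
    using R.one_closed by (simp add: scalars_def)
  have m: "\<ominus>\<^bsub>scalars K\<^esub> 1 \<in> carrier (scalars K)" using one by simp
  have "1 + \<ominus>\<^bsub>scalars K\<^esub> 1 = 0"
    using R.r_neg[OF one] by (simp add: scalars_def)
  then have m1: "\<ominus>\<^bsub>scalars K\<^esub> 1 = -1" by (simp add: add_eq_0_iff)
  have "\<ominus>\<^bsub>X\<^esub> x = (-1) \<odot>\<^bsub>X\<^esub> x"
    using smult_l_minus[OF one x] smult_one[OF x] m1 by (simp add: scalars_def)
  moreover have "-1 \<in> K" using m m1 by (simp add: scalars_def)
  ultimately show ?thesis using x by (simp add: vnorm_smult)
qed

lemma minus_flip: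
  assumes "x \<in> carrier X" "y \<in> carrier X"
  shows "y \<ominus>\<^bsub>X\<^esub> x = \<ominus>\<^bsub>X\<^esub> (x \<ominus>\<^bsub>X\<^esub> y)"
  using assms by (simp add: a_minus_def M.minus_add M.a_comm)

lemma minus_eq_zero_iff:
  assumes "x \<in> carrier X" "y \<in> carrier X"
  shows "x \<ominus>\<^bsub>X\<^esub> y = \<zero>\<^bsub>X\<^esub> \<longleftrightarrow> x = y"
  using assms by (metis M.add.inv_closed M.minus_equality M.minus_minus M.r_neg a_minus_def)

lemma minus_split:
  assumes "x \<in> carrier X" "y \<in> carrier X" "z \<in> carrier X"
  shows "x \<ominus>\<^bsub>X\<^esub> z = (x \<ominus>\<^bsub>X\<^esub> y) \<oplus>\<^bsub>X\<^esub> (y \<ominus>\<^bsub>X\<^esub> z)"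
proof -
  have "(x \<ominus>\<^bsub>X\<^esub> y) \<oplus>\<^bsub>X\<^esub> (y \<ominus>\<^bsub>X\<^esub> z) = x \<oplus>\<^bsub>X\<^esub> ((\<ominus>\<^bsub>X\<^esub> y \<oplus>\<^bsub>X\<^esub> y) \<oplus>\<^bsub>X\<^esub> \<ominus>\<^bsub>X\<^esub> z)"
    using assms by (simp add: a_minus_def M.a_assoc del: M.l_neg)
  then show ?thesis using assms by (simp add: M.l_neg a_minus_def)
qed

lemma Metric_space_vdist: "Metric_space (carrier X) (vdist X)"
proof
  fix x y show "0 \<le> vdist X x y"
    by (simp add: vdist_def vnorm_nonneg)
  show "vdist X x y = vdist X y x"
    using minus_flip[of x y] by (simp add: vdist_def vnorm_uminus)
next
  fix x y assume "x \<in> carrier X" "y \<in> carrier X"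
  then show "vdist X x y = 0 \<longleftrightarrow> x = y"
    by (simp add: vdist_def vnorm_eq_0_iff minus_eq_zero_iff)
next
  fix x y z assume "x \<in> carrier X" "y \<in> carrier X" "z \<in> carrier X"
  then show "vdist X x z \<le> vdist X x y + vdist X y z"
    using vnorm_triangle[of "x \<ominus>\<^bsub>X\<^esub> y" "y \<ominus>\<^bsub>X\<^esub> z"] minus_split[of x y z]
    by (simp add: vdist_def)
qed

end

locale banach_space = normed_space K X
  for K :: "complex set" and X :: "('a, 'm) nspace_scheme" (structure) +
  assumes complete: "Metric_space.mcomplete (carrier X) (vdist X)"

record 'a ipspace = "'a nspace" +
  ip :: "'a \<Rightarrow> 'a \<Rightarrow> complex"

locale hilbert_space = banach_space K H
  for K :: "complex set" and H :: "('a, 'm) ipspace_scheme" (structure) +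
  assumes ip_closed: "x \<in> carrier H \<Longrightarrow> y \<in> carrier H \<Longrightarrow> ip H x y \<in> K"
    and ip_add: "x \<in> carrier H \<Longrightarrow> y \<in> carrier H \<Longrightarrow> z \<in> carrier H \<Longrightarrow>
           ip H (x \<oplus>\<^bsub>H\<^esub> y) z = ip H x z + ip H y z"
    and ip_smult: "c \<in> K \<Longrightarrow> x \<in> carrier H \<Longrightarrow> y \<in> carrier H \<Longrightarrow>
           ip H (c \<odot>\<^bsub>H\<^esub> x) y = c * ip H x y"
    and ip_cnj: "x \<in> carrier H \<Longrightarrow> y \<in> carrier H \<Longrightarrow> ip H y x = cnj (ip H x y)"
    and ip_norm: "x \<in> carrier H \<Longrightarrow> ip H x x = complex_of_real ((vnorm H x)\<^sup>2)"


section \<open>Multilinear operators\<close>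

definition tuples :: "nat \<Rightarrow> (nat \<Rightarrow> ('a, 'm) nspace_scheme) \<Rightarrow> (nat \<Rightarrow> 'a) set" where
  "tuples n X = (\<Pi>\<^sub>E i\<in>{..<n}. carrier (X i))"

definition multilinear ::
  "complex set \<Rightarrow> nat \<Rightarrow> (nat \<Rightarrow> ('a, 'm) nspace_scheme) \<Rightarrow> ('b, 'l) nspace_scheme \<Rightarrow>
   ((nat \<Rightarrow> 'a) \<Rightarrow> 'b) \<Rightarrow> bool" where
  "multilinear K n X Y T \<longleftrightarrow>
     T \<in> tuples n X \<rightarrow> carrier Y \<and>
     (\<forall>u \<in> tuples n X. \<forall>i<n. \<forall>x \<in> carrier (X i). \<forall>y \<in> carrier (X i).
        T (u(i := x \<oplus>\<^bsub>X i\<^esub> y)) = T (u(i := x)) \<oplus>\<^bsub>Y\<^esub> T (u(i := y))) \<and>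
     (\<forall>u \<in> tuples n X. \<forall>i<n. \<forall>c \<in> K. \<forall>x \<in> carrier (X i).
        T (u(i := c \<odot>\<^bsub>X i\<^esub> x)) = c \<odot>\<^bsub>Y\<^esub> T (u(i := x)))"

definition unit_tuples :: "nat \<Rightarrow> (nat \<Rightarrow> ('a, 'm) nspace_scheme) \<Rightarrow> (nat \<Rightarrow> 'a) set" where
  "unit_tuples n X = {u \<in> tuples n X. \<forall>i<n. vnorm (X i) (u i) \<le> 1}"

definition bounded_multilinear ::
  "complex set \<Rightarrow> nat \<Rightarrow> (nat \<Rightarrow> ('a, 'm) nspace_scheme) \<Rightarrow> ('b, 'l) nspace_scheme \<Rightarrow>
   ((nat \<Rightarrow> 'a) \<Rightarrow> 'b) \<Rightarrow> bool" where
  "bounded_multilinear K n X Y T \<longleftrightarrow>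
     multilinear K n X Y T \<and> bdd_above ((\<lambda>u. vnorm Y (T u)) ` unit_tuples n X)"

definition mnorm ::
  "nat \<Rightarrow> (nat \<Rightarrow> ('a, 'm) nspace_scheme) \<Rightarrow> ('b, 'l) nspace_scheme \<Rightarrow>
   ((nat \<Rightarrow> 'a) \<Rightarrow> 'b) \<Rightarrow> real" where
  "mnorm n X Y T = (SUP u \<in> unit_tuples n X. vnorm Y (T u))"


section \<open>Lipschitz 2-summing operators\<close>

definition weak_lip2 ::
  "complex set \<Rightarrow> nat \<Rightarrow> (nat \<Rightarrow> ('a, 'm) nspace_scheme) \<Rightarrow> nat \<Rightarrow>
   (nat \<Rightarrow> nat \<Rightarrow> 'a) \<Rightarrow> (nat \<Rightarrow> nat \<Rightarrow> 'a) \<Rightarrow> real" where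
  "weak_lip2 K n X m u v =
     (SUP \<phi> \<in> {\<phi>. bounded_multilinear K n X (scalars K) \<phi> \<and> mnorm n X (scalars K) \<phi> \<le> 1}.
        sqrt (\<Sum>i<m. (cmod (\<phi> (u i) - \<phi> (v i)))\<^sup>2))"

definition lip2_bound ::
  "complex set \<Rightarrow> nat \<Rightarrow> (nat \<Rightarrow> ('a, 'm) nspace_scheme) \<Rightarrow> ('b, 'l) nspace_scheme \<Rightarrow>
   ((nat \<Rightarrow> 'a) \<Rightarrow> 'b) \<Rightarrow> real \<Rightarrow> bool" where
  "lip2_bound K n X Y T C \<longleftrightarrow> 0 \<le> C \<and>
     (\<forall>m u v. (\<forall>i<m. u i \<in> tuples n X \<and> v i \<in> tuples n X) \<longrightarrow>
        sqrt (\<Sum>i<m. (vnorm Y (T (u i) \<ominus>\<^bsub>Y\<^esub> T (v i)))\<^sup>2) \<le> C * weak_lip2 K n X m u v)"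

definition lip2_summing ::
  "complex set \<Rightarrow> nat \<Rightarrow> (nat \<Rightarrow> ('a, 'm) nspace_scheme) \<Rightarrow> ('b, 'l) nspace_scheme \<Rightarrow>
   ((nat \<Rightarrow> 'a) \<Rightarrow> 'b) \<Rightarrow> bool" where
  "lip2_summing K n X Y T \<longleftrightarrow>
     bounded_multilinear K n X Y T \<and> (\<exists>C. lip2_bound K n X Y T C)"

definition pi2_lip ::
  "complex set \<Rightarrow> nat \<Rightarrow> (nat \<Rightarrow> ('a, 'm) nspace_scheme) \<Rightarrow> ('b, 'l) nspace_scheme \<Rightarrow>
   ((nat \<Rightarrow> 'a) \<Rightarrow> 'b) \<Rightarrow> real" where
  "pi2_lip K n X Y T = Inf {C. lip2_bound K n X Y T C}"

lemma pi2_lip_is_least: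
  assumes "lip2_summing K n X Y T"
  shows "lip2_bound K n X Y T (pi2_lip K n X Y T)"
    and "lip2_bound K n X Y T C \<Longrightarrow> pi2_lip K n X Y T \<le> C"
proof -
  let ?S = "{C. lip2_bound K n X Y T C}"
  have ne: "?S \<noteq> {}" using assms by (auto simp: lip2_summing_def)
  have bb: "bdd_below ?S" by (rule bdd_belowI[of _ 0]) (auto simp: lip2_bound_def)
  have "closed ?S"
  proof -
    have "?S = {0..} \<inter> (\<Inter>(m,u,v) \<in> {(m,u,v). \<forall>i<m. u i \<in> tuples n X \<and> v i \<in> tuples n X}.
        {C. sqrt (\<Sum>i<m. (vnorm Y (T (u i) \<ominus>\<^bsub>Y\<^esub> T (v i)))\<^sup>2) \<le> C * weak_lip2 K n X m u v})"
      by (auto simp: lip2_bound_def)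
    moreover have "closed \<dots>"
      by (intro closed_Int closed_INT ballI closed_atLeast)
         (auto intro!: closed_Collect_le continuous_intros)
    ultimately show ?thesis by simp
  qed
  then show "lip2_bound K n X Y T (pi2_lip K n X Y T)"
    using closed_contains_Inf[OF ne bb] by (simp add: pi2_lip_def)
  show "lip2_bound K n X Y T C \<Longrightarrow> pi2_lip K n X Y T \<le> C"
    unfolding pi2_lip_def by (rule cInf_lower[OF _ bb]) simp
qed


section \<open>Factorization through a Hilbert space\<close>

definition lip_bound ::
  "('h, 'm) nspace_scheme \<Rightarrow> 'h set \<Rightarrow> ('b, 'l) nspace_scheme \<Rightarrow> ('h \<Rightarrow> 'b) \<Rightarrow> real \<Rightarrow> bool" where
  "lip_bound H M Y B L \<longleftrightarrow> 0 \<le> L \<and>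
     (\<forall>x\<in>M. \<forall>y\<in>M. vnorm Y (B x \<ominus>\<^bsub>Y\<^esub> B y) \<le> L * vnorm H (x \<ominus>\<^bsub>H\<^esub> y))"

definition lip_const ::
  "('h, 'm) nspace_scheme \<Rightarrow> 'h set \<Rightarrow> ('b, 'l) nspace_scheme \<Rightarrow> ('h \<Rightarrow> 'b) \<Rightarrow> real" where
  "lip_const H M Y B = Inf {L. lip_bound H M Y B L}"

definition hilbert_factorization ::
  "complex set \<Rightarrow> nat \<Rightarrow> (nat \<Rightarrow> ('a, 'm) nspace_scheme) \<Rightarrow> ('b, 'l) nspace_scheme \<Rightarrow>
   ((nat \<Rightarrow> 'a) \<Rightarrow> 'b) \<Rightarrow>
   ('h, 'k) ipspace_scheme \<Rightarrow> 'h set \<Rightarrow> ((nat \<Rightarrow> 'a) \<Rightarrow> 'h) \<Rightarrow> ('h \<Rightarrow> 'b) \<Rightarrow> bool" where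
  "hilbert_factorization K n X Y T H M A B \<longleftrightarrow>
     hilbert_space K H \<and> M \<subseteq> carrier H \<and>
     bounded_multilinear K n X H A \<and> A ` tuples n X \<subseteq> M \<and>
     B \<in> M \<rightarrow> carrier Y \<and> (\<exists>L. lip_bound H M Y B L) \<and>
     (\<forall>u \<in> tuples n X. T u = B (A u))"

text \<open>
  HOL cannot quantify over the type \<^typ>\<open>'h\<close> of points of the Hilbert space inside a definition, so
  below its points are taken to be scalar functions on tuples. This loses no factorization and
  leaves the infimum unchanged: only the closed span of the range of \<^term>\<open>A\<close> matters, and
  there a point \<^term>\<open>h\<close> is determined by the function sending \<^term>\<open>u\<close> to the inner product of
  \<^term>\<open>h\<close> and \<^term>\<open>A u\<close>. See \<open>factors_through_hilbertI\<close> and \<open>Gamma_le\<close>, where the type of points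
  is arbitrary.
\<close>

definition factors_through_hilbert ::
  "complex set \<Rightarrow> nat \<Rightarrow> (nat \<Rightarrow> ('a, 'm) nspace_scheme) \<Rightarrow> ('b, 'l) nspace_scheme \<Rightarrow>
   ((nat \<Rightarrow> 'a) \<Rightarrow> 'b) \<Rightarrow> bool" where
  "factors_through_hilbert K n X Y T \<longleftrightarrow>
     multilinear K n X Y T \<and>
     (\<exists>(H :: ((nat \<Rightarrow> 'a) \<Rightarrow> complex) ipspace) M A B. hilbert_factorization K n X Y T H M A B)"

definition Gamma_norm ::
  "complex set \<Rightarrow> nat \<Rightarrow> (nat \<Rightarrow> ('a, 'm) nspace_scheme) \<Rightarrow> ('b, 'l) nspace_scheme \<Rightarrow>
   ((nat \<Rightarrow> 'a) \<Rightarrow> 'b) \<Rightarrow> real" where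
  "Gamma_norm K n X Y T =
     Inf {mnorm n X H A * lip_const H M Y B |
            (H :: ((nat \<Rightarrow> 'a) \<Rightarrow> complex) ipspace) M A B.
          hilbert_factorization K n X Y T H M A B}"


subsection \<open>Independence of the type of points\<close>

lemma tuples_upd:
  "u \<in> tuples n X \<Longrightarrow> i < n \<Longrightarrow> x \<in> carrier (X i) \<Longrightarrow> u(i := x) \<in> tuples n X"
  by (auto simp: tuples_def PiE_iff extensional_def)

context hilbert_space
begin

lemma ip_add_right:
  assumes "x \<in> carrier H" "y \<in> carrier H" "z \<in> carrier H"
  shows "ip H z (x \<oplus>\<^bsub>H\<^esub> y) = ip H z x + ip H z y"
  using assms ip_cnj[of "x \<oplus>\<^bsub>H\<^esub> y" z] ip_cnj[of x z] ip_cnj[of y z] ip_add[of x y z]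
  by simp

lemma ip_smult_right:
  assumes "c \<in> K" "x \<in> carrier H" "z \<in> carrier H"
  shows "ip H z (c \<odot>\<^bsub>H\<^esub> x) = cnj c * ip H z x"
  using assms ip_cnj[of "c \<odot>\<^bsub>H\<^esub> x" z] ip_cnj[of x z] ip_smult[of c x z] smult_closed[of c x]
  by (simp add: scalars_def)

lemma ip_zero: "z \<in> carrier H \<Longrightarrow> ip H \<zero>\<^bsub>H\<^esub> z = 0"
  using ip_add[of "\<zero>\<^bsub>H\<^esub>" "\<zero>\<^bsub>H\<^esub>" z] by simp

lemma ip_minus:
  assumes "x \<in> carrier H" "z \<in> carrier H"
  shows "ip H (\<ominus>\<^bsub>H\<^esub> x) z = - ip H x z"
proof -
  have "ip H x z + ip H (\<ominus>\<^bsub>H\<^esub> x) z = 0"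
    using assms ip_add[of x "\<ominus>\<^bsub>H\<^esub> x" z] by (simp add: ip_zero M.r_neg)
  then show ?thesis by (simp add: add_eq_0_iff)
qed

lemma ip_diff:
  assumes "x \<in> carrier H" "y \<in> carrier H" "z \<in> carrier H"
  shows "ip H (x \<ominus>\<^bsub>H\<^esub> y) z = ip H x z - ip H y z"
  using assms by (simp add: a_minus_def ip_add ip_minus)

lemma Cauchy_Schwarz:
  assumes x: "x \<in> carrier H" and y: "y \<in> carrier H"
  shows "cmod (ip H x y) \<le> vnorm H x * vnorm H y"
proof (cases "y = \<zero>\<^bsub>H\<^esub>")
  case True
  have "ip H x y = 0" using ip_cnj[OF y x] ip_zero[OF x] True by simp
  then show ?thesis using x y by (simp add: vnorm_nonneg)
next
  case False
  define a where "a = ip H x y"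
  define N where "N = (vnorm H y)\<^sup>2"
  have Npos: "N > 0" using False y vnorm_eq_0_iff[OF y] by (simp add: N_def)
  have aK: "a \<in> carrier (scalars K)" using ip_closed x y by (simp add: a_def scalars_def)
  have NK: "of_real N \<in> carrier (scalars K)"
    using ip_closed[OF y y] ip_norm[OF y] by (simp add: N_def scalars_def)
  have aK': "a \<in> K" and NK': "complex_of_real N \<in> K" using aK NK by (auto simp: scalars_def)
  define p where "p = complex_of_real N \<odot>\<^bsub>H\<^esub> x"
  define q where "q = a \<odot>\<^bsub>H\<^esub> y"
  have p: "p \<in> carrier H" and q: "q \<in> carrier H"
    using smult_closed[OF NK x] smult_closed[OF aK y] by (auto simp: p_def q_def)
  have ipp: "ip H p w = of_real N * ip H x w" and ipq: "ip H q w = a * ip H y w"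
    if "w \<in> carrier H" for w
    using that x y aK' NK' by (simp_all add: p_def q_def ip_smult)
  have ipx: "ip H w p = of_real N * ip H w x" and ipy: "ip H w q = cnj a * ip H w y"
    if "w \<in> carrier H" for w
    using that x y aK' NK' by (simp_all add: p_def q_def ip_smult_right)
  let ?z = "p \<ominus>\<^bsub>H\<^esub> q"
  have z: "?z \<in> carrier H" using p q by simp
  have yx: "ip H y x = cnj a" using ip_cnj[OF x y] by (simp add: a_def)
  have yy: "ip H y y = of_real N" using ip_norm[OF y] by (simp add: N_def)
  have zz: "ip H ?z w = of_real N * ip H x w - a * ip H y w" if "w \<in> carrier H" for w
    using that p q ip_diff by (simp add: ipp ipq)
  have zp: "ip H x ?z = cnj (of_real N * ip H x x - a * ip H y x)"
    using ip_cnj[OF z x] zz[OF x] by simp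
  have zq: "ip H y ?z = cnj (of_real N * ip H x y - a * ip H y y)"
    using ip_cnj[OF z y] zz[OF y] by simp
  have zq0: "ip H y ?z = 0" using zq by (simp add: yy a_def[symmetric])
  have "ip H ?z ?z = of_real N * cnj (of_real N * of_real ((vnorm H x)\<^sup>2) - a * cnj a)"
    using zz[OF z] zp zq0 ip_norm[OF x] yx by simp
  also have "\<dots> = of_real (N * (N * (vnorm H x)\<^sup>2 - (cmod a)\<^sup>2))"
    by (simp add: complex_norm_square[symmetric] del: of_real_power)
  finally have "complex_of_real ((vnorm H ?z)\<^sup>2) = of_real (N * (N * (vnorm H x)\<^sup>2 - (cmod a)\<^sup>2))"
    using ip_norm[OF z] by simp
  then have "(vnorm H ?z)\<^sup>2 = N * (N * (vnorm H x)\<^sup>2 - (cmod a)\<^sup>2)"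
    using of_real_eq_iff by blast
  then have "0 \<le> N * (N * (vnorm H x)\<^sup>2 - (cmod a)\<^sup>2)" by (metis zero_le_power2)
  then have "0 \<le> N * (vnorm H x)\<^sup>2 - (cmod a)\<^sup>2"
    using Npos by (simp only: zero_le_mult_iff) linarith
  then have "(cmod a)\<^sup>2 \<le> (vnorm H x * vnorm H y)\<^sup>2"
    by (simp add: N_def power_mult_distrib mult.commute)
  then show ?thesis
    unfolding a_def using x y by (metis power2_le_imp_le vnorm_nonneg mult_nonneg_nonneg)
qed

end

lemma hilbert_space_transport:
  fixes H :: "('h, 'k) ipspace_scheme" and A :: "'p \<Rightarrow> 'h"
  assumes HS: "hilbert_space K H" and A: "A \<in> P \<rightarrow> carrier H"
  obtains H' :: "('p \<Rightarrow> complex) ipspace" and S and J :: "'h \<Rightarrow> 'p \<Rightarrow> complex"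
  where "hilbert_space K H'" "S \<subseteq> carrier H" "A ` P \<subseteq> S" "inj_on J S" "carrier H' = J ` S"
    "\<And>x y. x \<in> S \<Longrightarrow> y \<in> S \<Longrightarrow> x \<oplus>\<^bsub>H\<^esub> y \<in> S \<and> J (x \<oplus>\<^bsub>H\<^esub> y) = J x \<oplus>\<^bsub>H'\<^esub> J y"
    "\<And>x y. x \<in> S \<Longrightarrow> y \<in> S \<Longrightarrow> x \<ominus>\<^bsub>H\<^esub> y \<in> S \<and> J (x \<ominus>\<^bsub>H\<^esub> y) = J x \<ominus>\<^bsub>H'\<^esub> J y"
    "\<And>c x. c \<in> K \<Longrightarrow> x \<in> S \<Longrightarrow> c \<odot>\<^bsub>H\<^esub> x \<in> S \<and> J (c \<odot>\<^bsub>H\<^esub> x) = c \<odot>\<^bsub>H'\<^esub> J x"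
    "\<And>x. x \<in> S \<Longrightarrow> vnorm H' (J x) = vnorm H x"
proof -
  interpret H: hilbert_space K H by (rule HS)
  define S where "S = {h \<in> carrier H. \<forall>w \<in> carrier H. (\<forall>u\<in>P. ip H w (A u) = 0) \<longrightarrow> ip H h w = 0}"
  define J where "J = (\<lambda>h u. if u \<in> P then ip H h (A u) else 0)"
  define I where "I = inv_into S J"
  define H' :: "('p \<Rightarrow> complex) ipspace" where
    "H' = \<lparr>carrier = J ` S, mult = (\<lambda>f g. f), one = (\<lambda>u. 0), zero = (\<lambda>u. 0),
       add = (\<lambda>f g u. f u + g u), smult = (\<lambda>c f u. c * f u), vnorm = (\<lambda>f. vnorm H (I f)),
       ip = (\<lambda>f g. ip H (I f) (I g))\<rparr>"
  have AH: "A u \<in> carrier H" if "u \<in> P" for u using A that by auto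
  have SH: "S \<subseteq> carrier H" by (auto simp: S_def)
  note SH' = subsetD[OF SH]
  have AS: "A ` P \<subseteq> S"
  proof clarsimp
    fix u assume u: "u \<in> P"
    have "ip H (A u) w = 0" if "w \<in> carrier H" "\<forall>u\<in>P. ip H w (A u) = 0" for w
      using H.ip_cnj[OF that(1) AH[OF u]] that u by simp
    then show "A u \<in> S" using AH[OF u] by (simp add: S_def)
  qed
  have S0: "\<zero>\<^bsub>H\<^esub> \<in> S" and J0: "J \<zero>\<^bsub>H\<^esub> = (\<lambda>u. 0)"
    by (auto simp: S_def J_def H.ip_zero AH)
  have Sadd: "x \<oplus>\<^bsub>H\<^esub> y \<in> S" if "x \<in> S" "y \<in> S" for x y
    using that by (auto simp: S_def H.ip_add)
  have Sneg: "\<ominus>\<^bsub>H\<^esub> x \<in> S" if "x \<in> S" for x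
    using that by (auto simp: S_def H.ip_minus)
  have Smin: "x \<ominus>\<^bsub>H\<^esub> y \<in> S" if "x \<in> S" "y \<in> S" for x y
    using that by (simp add: a_minus_def Sadd Sneg)
  have cs: "carrier (scalars K) = K" by (simp add: scalars_def)
  have Ssm: "c \<odot>\<^bsub>H\<^esub> x \<in> S" if "c \<in> K" "x \<in> S" for c x
    using that H.smult_closed[of c x] by (auto simp: S_def H.ip_smult cs)
  have Jadd: "J (x \<oplus>\<^bsub>H\<^esub> y) = (\<lambda>u. J x u + J y u)" if "x \<in> S" "y \<in> S" for x y
    using that by (auto simp: J_def H.ip_add AH SH')
  have Jneg: "J (\<ominus>\<^bsub>H\<^esub> x) = (\<lambda>u. - J x u)" if "x \<in> S" for x
    using that by (auto simp: J_def H.ip_minus AH SH')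
  have Jsm: "J (c \<odot>\<^bsub>H\<^esub> x) = (\<lambda>u. c * J x u)" if "c \<in> K" "x \<in> S" for c x
    using that by (auto simp: J_def H.ip_smult AH SH')
  have inj: "inj_on J S"
  proof (rule inj_onI)
    fix x y assume x: "x \<in> S" and y: "y \<in> S" and eq: "J x = J y"
    let ?d = "x \<ominus>\<^bsub>H\<^esub> y"
    have d: "?d \<in> S" using Smin x y by simp
    have "ip H ?d (A u) = 0" if "u \<in> P" for u
      using fun_cong[OF eq, of u] that x y by (simp add: J_def H.ip_diff SH' AH)
    then have "ip H ?d ?d = 0" using d by (auto simp: S_def)
    then have "vnorm H ?d = 0" using H.ip_norm[OF SH'[OF d]] by simp
    then have "?d = \<zero>\<^bsub>H\<^esub>" using H.vnorm_eq_0_iff[OF SH'[OF d]] by simp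
    then show "x = y" using x y H.minus_eq_zero_iff by (simp add: SH')
  qed
  have IJ: "I (J x) = x" if "x \<in> S" for x using that inj by (simp add: I_def)
  have H'_simps [simp]: "carrier H' = J ` S" "zero H' = (\<lambda>u. 0)"
    "add H' = (\<lambda>f g u. f u + g u)" "smult H' = (\<lambda>c f u. c * f u)"
    "vnorm H' = (\<lambda>f. vnorm H (I f))" "ip H' = (\<lambda>f g. ip H (I f) (I g))"
    by (simp_all add: H'_def)
  have scs: "add (scalars K) = (+)" "mult (scalars K) = (*)" "one (scalars K) = 1" "zero (scalars K) = 0"
    by (simp_all add: scalars_def)
  have ab: "abelian_group H'"
  proof (rule abelian_groupI)
    fix f g assume "f \<in> carrier H'" "g \<in> carrier H'"
    then show "f \<oplus>\<^bsub>H'\<^esub> g \<in> carrier H'"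
      using Jadd Sadd by (auto simp: image_iff) metis
  next
    show "\<zero>\<^bsub>H'\<^esub> \<in> carrier H'" using J0 S0 by (auto simp: image_iff) metis
  next
    fix f assume "f \<in> carrier H'"
    then obtain x where x: "x \<in> S" "f = J x" by auto
    then show "\<exists>y\<in>carrier H'. y \<oplus>\<^bsub>H'\<^esub> f = \<zero>\<^bsub>H'\<^esub>"
      using Jneg[OF x(1)] imageI[OF Sneg[OF x(1)], of J]
      by (intro bexI[of _ "J (\<ominus>\<^bsub>H\<^esub> x)"]) (simp_all add: x(2))
  qed (auto simp: algebra_simps)
  have mod: "Module.module (scalars K) H'"
  proof (rule moduleI)
    fix a f assume "a \<in> carrier (scalars K)" "f \<in> carrier H'"
    then show "a \<odot>\<^bsub>H'\<^esub> f \<in> carrier H'"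
      using Jsm Ssm by (auto simp: image_iff cs) metis
  qed (auto simp: ab H.R.is_cring scs algebra_simps)
  have ns: "normed_space K H'"
  proof (intro normed_space.intro mod normed_space_axioms.intro)
    fix f assume "f \<in> carrier H'"
    then obtain x where x: "x \<in> S" "f = J x" by auto
    then show "0 \<le> vnorm H' f" by (simp add: IJ H.vnorm_nonneg SH')
    show "vnorm H' f = 0 \<longleftrightarrow> f = \<zero>\<^bsub>H'\<^esub>"
      using x J0 inj S0 by (simp add: IJ H.vnorm_eq_0_iff SH' inj_on_eq_iff flip: J0)
    fix c assume "c \<in> K"
    then show "vnorm H' (c \<odot>\<^bsub>H'\<^esub> f) = cmod c * vnorm H' f"
      using x Jsm[of c x, symmetric] by (simp add: IJ Ssm H.vnorm_smult SH')
  next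
    fix f g assume "f \<in> carrier H'" "g \<in> carrier H'"
    then obtain x y where x: "x \<in> S" "f = J x" "y \<in> S" "g = J y" by auto
    then show "vnorm H' (f \<oplus>\<^bsub>H'\<^esub> g) \<le> vnorm H' f + vnorm H' g"
      using Jadd[of x y, symmetric] by (simp add: IJ Sadd H.vnorm_triangle SH')
  qed
  interpret H': normed_space K H' by (rule ns)
  have Jmin: "J (x \<ominus>\<^bsub>H\<^esub> y) = J x \<ominus>\<^bsub>H'\<^esub> J y" if "x \<in> S" "y \<in> S" for x y
  proof -
    have c: "J (x \<ominus>\<^bsub>H\<^esub> y) \<in> carrier H'" "J x \<in> carrier H'" "J y \<in> carrier H'"
      using that Smin by auto
    have "J (x \<ominus>\<^bsub>H\<^esub> y) \<oplus>\<^bsub>H'\<^esub> J y = J x"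
      using that Jneg[of y] Jadd[of x "\<ominus>\<^bsub>H\<^esub> y"] Sneg by (auto simp: a_minus_def)
    then have "J x \<ominus>\<^bsub>H'\<^esub> J y = J (x \<ominus>\<^bsub>H\<^esub> y) \<oplus>\<^bsub>H'\<^esub> J y \<oplus>\<^bsub>H'\<^esub> \<ominus>\<^bsub>H'\<^esub> J y"
      by (simp only: a_minus_def)
    also have "\<dots> = J (x \<ominus>\<^bsub>H\<^esub> y) \<oplus>\<^bsub>H'\<^esub> (J y \<oplus>\<^bsub>H'\<^esub> \<ominus>\<^bsub>H'\<^esub> J y)"
      using c by (intro H'.M.a_assoc) (simp_all only: H'.M.a_inv_closed)
    also have "\<dots> = J (x \<ominus>\<^bsub>H\<^esub> y)"
      using c by (simp only: H'.M.r_neg H'.M.r_zero)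
    finally show ?thesis by simp
  qed
  have dist: "vdist H' (J x) (J y) = vdist H x y" if "x \<in> S" "y \<in> S" for x y
    using that by (simp add: vdist_def SH' IJ Smin flip: Jmin)
  interpret mH: Metric_space "carrier H" "vdist H" by (rule H.Metric_space_vdist)
  interpret mH': Metric_space "carrier H'" "vdist H'" by (rule H'.Metric_space_vdist)
  have "mH'.mcomplete"
    unfolding mH'.mcomplete_def
  proof (intro allI impI)
    fix \<sigma> assume c: "mH'.MCauchy \<sigma>"
    then have r: "\<sigma> k \<in> J ` S" for k
      unfolding mH'.MCauchy_def by auto
    define \<tau> where "\<tau> = (\<lambda>k. I (\<sigma> k))"
    have \<tau>: "\<tau> k \<in> S" "\<sigma> k = J (\<tau> k)" for k using r[of k] by (auto simp: \<tau>_def IJ)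
    have "mH.MCauchy \<tau>"
      unfolding mH.MCauchy_def
    proof
      show "range \<tau> \<subseteq> carrier H" using \<tau> SH by auto
      show "\<forall>\<epsilon>>0. \<exists>N. \<forall>n n'. N \<le> n \<longrightarrow> N \<le> n' \<longrightarrow> vdist H (\<tau> n) (\<tau> n') < \<epsilon>"
        using c unfolding mH'.MCauchy_def by (simp only: \<tau>(2) dist[OF \<tau>(1) \<tau>(1)]) blast
    qed
    then obtain l where l: "limitin mH.mtopology \<tau> l sequentially"
      using H.complete mH.mcomplete_def by blast
    then have lH: "l \<in> carrier H"
      and conv: "\<And>\<epsilon>. \<epsilon> > 0 \<Longrightarrow> \<exists>N. \<forall>k\<ge>N. \<tau> k \<in> carrier H \<and> vdist H (\<tau> k) l < \<epsilon>"
      by (auto simp: mH.limit_metric_sequentially)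
    have "ip H l w = 0" if w: "w \<in> carrier H" and orth: "\<forall>u\<in>P. ip H w (A u) = 0" for w
    proof (rule ccontr)
      assume ne: "ip H l w \<noteq> 0"
      have le: "cmod (ip H l w) \<le> vdist H (\<tau> k) l * vnorm H w" for k
      proof -
        have tw: "ip H (\<tau> k) w = 0" using \<tau>(1)[of k] w orth by (auto simp: S_def)
        have tH: "\<tau> k \<in> carrier H" using \<tau>(1) SH' by blast
        have "ip H (\<tau> k \<ominus>\<^bsub>H\<^esub> l) w = - ip H l w"
          using H.ip_diff[OF tH lH w] tw by simp
        then have "cmod (ip H l w) = cmod (ip H (\<tau> k \<ominus>\<^bsub>H\<^esub> l) w)" by simp
        also have "\<dots> \<le> vnorm H (\<tau> k \<ominus>\<^bsub>H\<^esub> l) * vnorm H w"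
          using tH lH w by (intro H.Cauchy_Schwarz) auto
        finally show ?thesis using tH lH by (simp add: vdist_def)
      qed
      define e where "e = cmod (ip H l w) / (vnorm H w + 1)"
      have w0: "vnorm H w \<ge> 0" using w by (rule H.vnorm_nonneg)
      have e: "e > 0" using ne w0 by (simp add: e_def)
      obtain k where k: "vdist H (\<tau> k) l < e" using conv[OF e] by blast
      have "cmod (ip H l w) \<le> e * vnorm H w"
        using le[of k] k w0 by (meson less_eq_real_def mult_right_mono order_trans)
      also have "\<dots> < e * (vnorm H w + 1)" using e by simp
      also have "\<dots> = cmod (ip H l w)" using w0 by (simp add: e_def)
      finally show False by simp
    qed
    then have lS: "l \<in> S" using lH by (simp add: S_def)
    have "limitin mH'.mtopology \<sigma> (J l) sequentially"
      unfolding mH'.limit_metric_sequentially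
    proof (intro conjI allI impI)
      show "J l \<in> carrier H'" using lS by simp
      fix \<epsilon> :: real assume "\<epsilon> > 0"
      then obtain N where "\<forall>k\<ge>N. vdist H (\<tau> k) l < \<epsilon>" using conv by blast
      then have "\<forall>k\<ge>N. \<sigma> k \<in> carrier H' \<and> vdist H' (\<sigma> k) (J l) < \<epsilon>"
        using dist[OF \<tau>(1) lS] \<tau> by auto
      then show "\<exists>N. \<forall>k\<ge>N. \<sigma> k \<in> carrier H' \<and> vdist H' (\<sigma> k) (J l) < \<epsilon>" by blast
    qed
    then show "\<exists>x. limitin mH'.mtopology \<sigma> x sequentially" by blast
  qed
  then have bs: "banach_space K H'"
    by (intro banach_space.intro ns banach_space_axioms.intro)
  have hs: "hilbert_space K H'"
  proof (intro hilbert_space.intro bs hilbert_space_axioms.intro)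
    fix f g assume "f \<in> carrier H'" "g \<in> carrier H'"
    then obtain x y where x: "x \<in> S" "f = J x" "y \<in> S" "g = J y" by auto
    show "ip H' f g \<in> K" using x by (simp add: IJ H.ip_closed SH')
    show "ip H' g f = cnj (ip H' f g)" using x H.ip_cnj[of x y] by (simp add: IJ SH')
    fix c assume "c \<in> K"
    then show "ip H' (c \<odot>\<^bsub>H'\<^esub> f) g = c * ip H' f g"
      using x Jsm[of c x, symmetric] by (simp add: IJ Ssm H.ip_smult SH')
  next
    fix f assume "f \<in> carrier H'"
    then show "ip H' f f = complex_of_real ((vnorm H' f)\<^sup>2)"
      using H.ip_norm by (auto simp: IJ SH')
  next
    fix f g h assume "f \<in> carrier H'" "g \<in> carrier H'" "h \<in> carrier H'"
    then obtain x y z where x: "x \<in> S" "f = J x" "y \<in> S" "g = J y" "z \<in> S" "h = J z" by auto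
    then show "ip H' (f \<oplus>\<^bsub>H'\<^esub> g) h = ip H' f h + ip H' g h"
      using Jadd[of x y, symmetric] by (simp add: IJ Sadd H.ip_add SH')
  qed
  show thesis
    by (rule that[OF hs SH AS inj]) (simp_all add: Sadd Jadd Smin Jmin Ssm Jsm IJ)
qed

lemma hilbert_factorization_transport:
  fixes X :: "nat \<Rightarrow> ('a, 'm) nspace_scheme" and H :: "('h, 'k) ipspace_scheme"
  assumes X: "\<And>i. i < n \<Longrightarrow> normed_space K (X i)"
    and F: "hilbert_factorization K n X Y T H M A B"
  obtains H' :: "((nat \<Rightarrow> 'a) \<Rightarrow> complex) ipspace" and M' A' B'
  where "hilbert_factorization K n X Y T H' M' A' B'"
    "mnorm n X H' A' = mnorm n X H A" "lip_const H' M' Y B' \<le> lip_const H M Y B"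
proof -
  let ?P = "tuples n X"
  have HS: "hilbert_space K H" and MH: "M \<subseteq> carrier H" and bA: "bounded_multilinear K n X H A"
    and AM: "A ` ?P \<subseteq> M" and BM: "B \<in> M \<rightarrow> carrier Y" and LB: "\<exists>L. lip_bound H M Y B L"
    and TB: "\<And>u. u \<in> ?P \<Longrightarrow> T u = B (A u)"
    using F by (auto simp: hilbert_factorization_def)
  have mA: "multilinear K n X H A" and bd: "bdd_above ((\<lambda>u. vnorm H (A u)) ` unit_tuples n X)"
    using bA by (auto simp: bounded_multilinear_def)
  have A: "A \<in> ?P \<rightarrow> carrier H" using mA by (simp add: multilinear_def)
  obtain H' :: "((nat \<Rightarrow> 'a) \<Rightarrow> complex) ipspace" and S J
    where hs: "hilbert_space K H'" and SH: "S \<subseteq> carrier H" and AS: "A ` ?P \<subseteq> S"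
    and inj: "inj_on J S" and car: "carrier H' = J ` S"
    and add: "\<And>x y. x \<in> S \<Longrightarrow> y \<in> S \<Longrightarrow> x \<oplus>\<^bsub>H\<^esub> y \<in> S \<and> J (x \<oplus>\<^bsub>H\<^esub> y) = J x \<oplus>\<^bsub>H'\<^esub> J y"
    and min: "\<And>x y. x \<in> S \<Longrightarrow> y \<in> S \<Longrightarrow> x \<ominus>\<^bsub>H\<^esub> y \<in> S \<and> J (x \<ominus>\<^bsub>H\<^esub> y) = J x \<ominus>\<^bsub>H'\<^esub> J y"
    and sm: "\<And>c x. c \<in> K \<Longrightarrow> x \<in> S \<Longrightarrow> c \<odot>\<^bsub>H\<^esub> x \<in> S \<and> J (c \<odot>\<^bsub>H\<^esub> x) = c \<odot>\<^bsub>H'\<^esub> J x"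
    and nrm: "\<And>x. x \<in> S \<Longrightarrow> vnorm H' (J x) = vnorm H x"
    by (rule hilbert_space_transport[OF HS A]) (rule that)
  define A' where "A' = (\<lambda>u. J (A u))"
  define M' where "M' = J ` (M \<inter> S)"
  define B' where "B' = (\<lambda>f. B (inv_into S J f))"
  have IJ: "inv_into S J (J x) = x" if "x \<in> S" for x using that inj by simp
  have AuS: "A u \<in> S" "A u \<in> M" if "u \<in> ?P" for u using AS AM that by auto
  have nA: "vnorm H' (A' u) = vnorm H (A u)" if "u \<in> ?P" for u
    using that by (simp add: A'_def nrm AuS)
  have uP: "u \<in> ?P" if "u \<in> unit_tuples n X" for u using that by (simp add: unit_tuples_def)
  have img: "(\<lambda>u. vnorm H' (A' u)) ` unit_tuples n X = (\<lambda>u. vnorm H (A u)) ` unit_tuples n X"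
    by (rule image_cong[OF refl nA[OF uP]])
  have "multilinear K n X H' A'"
    unfolding multilinear_def
  proof (intro conjI ballI allI impI)
    show "A' \<in> ?P \<rightarrow> carrier H'" using AuS car by (auto simp: A'_def)
  next
    fix u i x y assume u: "u \<in> ?P" and i: "i < n" and x: "x \<in> carrier (X i)" "y \<in> carrier (X i)"
    have "A (u(i := x \<oplus>\<^bsub>X i\<^esub> y)) = A (u(i := x)) \<oplus>\<^bsub>H\<^esub> A (u(i := y))"
      using mA u i x by (simp add: multilinear_def)
    then show "A' (u(i := x \<oplus>\<^bsub>X i\<^esub> y)) = A' (u(i := x)) \<oplus>\<^bsub>H'\<^esub> A' (u(i := y))"
      using add[OF AuS(1) AuS(1), OF tuples_upd[OF u i x(1)] tuples_upd[OF u i x(2)]]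
      by (simp add: A'_def)
  next
    fix u i c x assume u: "u \<in> ?P" and i: "i < n" and c: "c \<in> K" and x: "x \<in> carrier (X i)"
    have "A (u(i := c \<odot>\<^bsub>X i\<^esub> x)) = c \<odot>\<^bsub>H\<^esub> A (u(i := x))"
      using mA u i c x by (simp add: multilinear_def)
    then show "A' (u(i := c \<odot>\<^bsub>X i\<^esub> x)) = c \<odot>\<^bsub>H'\<^esub> A' (u(i := x))"
      using sm[OF c AuS(1), OF tuples_upd[OF u i x]] by (simp add: A'_def)
  qed
  then have bA': "bounded_multilinear K n X H' A'"
    using bd img by (simp add: bounded_multilinear_def)
  have lip: "lip_bound H' M' Y B' L" if "lip_bound H M Y B L" for L
    unfolding lip_bound_def
  proof (intro conjI ballI)
    show "0 \<le> L" using that by (simp add: lip_bound_def)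
    fix f g assume "f \<in> M'" "g \<in> M'"
    then obtain x y where x: "x \<in> M" "x \<in> S" "f = J x" "y \<in> M" "y \<in> S" "g = J y"
      by (auto simp: M'_def)
    have "vnorm H' (f \<ominus>\<^bsub>H'\<^esub> g) = vnorm H (x \<ominus>\<^bsub>H\<^esub> y)"
      using x min[of x y] nrm[of "x \<ominus>\<^bsub>H\<^esub> y"] by simp
    then show "vnorm Y (B' f \<ominus>\<^bsub>Y\<^esub> B' g) \<le> L * vnorm H' (f \<ominus>\<^bsub>H'\<^esub> g)"
      using that x by (simp add: lip_bound_def B'_def IJ)
  qed
  have "hilbert_factorization K n X Y T H' M' A' B'"
    unfolding hilbert_factorization_def
  proof (intro conjI ballI)
    show "hilbert_space K H'" by (rule hs)
    show "M' \<subseteq> carrier H'" by (auto simp: M'_def car)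
    show "bounded_multilinear K n X H' A'" by (rule bA')
    show "A' ` ?P \<subseteq> M'" using AuS by (auto simp: A'_def M'_def)
    show "B' \<in> M' \<rightarrow> carrier Y" using BM by (auto simp: M'_def B'_def IJ)
    show "\<exists>L. lip_bound H' M' Y B' L" using LB lip by blast
    fix u assume "u \<in> ?P"
    then show "T u = B' (A' u)" using TB AuS by (simp add: A'_def B'_def IJ)
  qed
  moreover have "mnorm n X H' A' = mnorm n X H A" by (simp add: mnorm_def img)
  moreover have "lip_const H' M' Y B' \<le> lip_const H M Y B"
    unfolding lip_const_def
  proof (rule cInf_superset_mono)
    show "{L. lip_bound H M Y B L} \<noteq> {}" using LB by auto
    show "bdd_below {L. lip_bound H' M' Y B' L}"
      by (rule bdd_belowI[of _ 0]) (auto simp: lip_bound_def)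
  qed (use lip in auto)
  ultimately show thesis by (rule that)
qed

lemma factors_through_hilbertI:
  fixes X :: "nat \<Rightarrow> ('a, 'm) nspace_scheme" and H :: "('h, 'k) ipspace_scheme"
  assumes "\<And>i. i < n \<Longrightarrow> normed_space K (X i)"
    and "multilinear K n X Y T" and "hilbert_factorization K n X Y T H M A B"
  shows "factors_through_hilbert K n X Y T"
  using hilbert_factorization_transport[OF assms(1,3)] assms(2)
  unfolding factors_through_hilbert_def by metis

lemma mnorm_nonneg:
  assumes X: "\<And>i. i < n \<Longrightarrow> normed_space K (X i)" and Y: "normed_space K Y"
    and A: "bounded_multilinear K n X Y A"
  shows "0 \<le> mnorm n X Y A"
proof -
  define z where "z = (\<lambda>i\<in>{..<n}. \<zero>\<^bsub>X i\<^esub>)"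
  have "\<zero>\<^bsub>X i\<^esub> \<in> carrier (X i) \<and> vnorm (X i) \<zero>\<^bsub>X i\<^esub> = 0" if "i < n" for i
  proof -
    interpret normed_space K "X i" by (rule X[OF that])
    show ?thesis by (simp add: vnorm_zero)
  qed
  then have z: "z \<in> unit_tuples n X" by (auto simp: unit_tuples_def tuples_def z_def)
  then have "A z \<in> carrier Y"
    using A by (auto simp: unit_tuples_def bounded_multilinear_def multilinear_def)
  then have "0 \<le> vnorm Y (A z)" by (rule normed_space.vnorm_nonneg[OF Y])
  also have "\<dots> \<le> mnorm n X Y A"
    unfolding mnorm_def using A z by (intro cSUP_upper) (auto simp: bounded_multilinear_def)
  finally show ?thesis .
qed

lemma lip_const_nonneg:
  assumes "\<exists>L. lip_bound H M Y B L"
  shows "0 \<le> lip_const H M Y B"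
  unfolding lip_const_def using assms by (intro cInf_greatest) (auto simp: lip_bound_def)

lemma Gamma_le:
  fixes X :: "nat \<Rightarrow> ('a, 'm) nspace_scheme" and H :: "('h, 'k) ipspace_scheme"
  assumes X: "\<And>i. i < n \<Longrightarrow> normed_space K (X i)"
    and F: "hilbert_factorization K n X Y T H M A B"
  shows "Gamma_norm K n X Y T \<le> mnorm n X H A * lip_const H M Y B"
proof -
  have nonneg: "0 \<le> mnorm n X H A" "0 \<le> lip_const H M Y B"
    if "hilbert_factorization K n X Y T H M A B"
    for H :: "('z, 'w) ipspace_scheme" and M A B
  proof -
    have "normed_space K H"
      using that by (auto simp: hilbert_factorization_def hilbert_space_def banach_space_def)
    then show "0 \<le> mnorm n X H A"
      using that by (intro mnorm_nonneg[OF X]) (auto simp: hilbert_factorization_def)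
    show "0 \<le> lip_const H M Y B"
      using that by (intro lip_const_nonneg) (auto simp: hilbert_factorization_def)
  qed
  obtain H' :: "((nat \<Rightarrow> 'a) \<Rightarrow> complex) ipspace" and M' A' B'
    where F': "hilbert_factorization K n X Y T H' M' A' B'"
    and eq: "mnorm n X H' A' = mnorm n X H A" "lip_const H' M' Y B' \<le> lip_const H M Y B"
    by (rule hilbert_factorization_transport[OF X F])
  have "Gamma_norm K n X Y T \<le> mnorm n X H' A' * lip_const H' M' Y B'"
    unfolding Gamma_norm_def
  proof (rule cInf_lower)
    show "bdd_below {mnorm n X H A * lip_const H M Y B |
            (H :: ((nat \<Rightarrow> 'a) \<Rightarrow> complex) ipspace) M A B.
          hilbert_factorization K n X Y T H M A B}"
      by (rule bdd_belowI[of _ 0]) (auto intro!: mult_nonneg_nonneg nonneg)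
  qed (use F' in blast)
  also have "\<dots> \<le> mnorm n X H A * lip_const H M Y B"
    using eq nonneg(1)[OF F'] by (simp add: mult_left_mono)
  finally show ?thesis .
qed

end

(*
  The positive semidefinite kernels q on tuples that are multilinear in the first variable and
  satisfy |q(s,t)| <= prod |s_i| prod |t_i| form a convex set, compact for pointwise convergence,
  which contains phi(s) cnj(phi(t)) for every form phi of norm at most 1. A minimax argument turns
  the 2-summing inequality into one such q with
    |T u - T v|^2 <= C^2 (q(u,u) - q(u,v) - q(v,u) + q(v,v))
  for all u, v (it plays the role of the measure in Pietsch's domination theorem). In the Hilbert
  space with reproducing kernel q the right-hand side is C^2 |q(u,.) - q(v,.)|^2, so
  A u = q(u,.) has norm at most 1 and T u depends on A u in a C-Lipschitz way.
*)
theory Submission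
  imports Defs
begin

text \<open>Pietsch's argument puts a measure on the unit ball of the forms and maps into an L2
  space. A kernel of the set need not be a mixture of rank-one kernels: a larger set only makes it
  easier to find a dominating element, and the conditions that define it are what compactness and
  the factorization require. The obstacle in the minimax step is that it puts weights on finitely
  many pairs, whereas the summing inequality has none. Scaling one coordinate of both tuples by the
  root of a weight multiplies the squared differences of \<open>T\<close> and of every form by that
  weight, so the inequality holds with weights and the same constant.\<close>

section \<open>A minimax theorem\<close>

text \<open>
  Minimise the sum of the squares of \<open>max 0 (b i - d i k)\<close> over \<open>D\<close>: the positive parts at the
  minimiser, taken as weights, contradict \<open>dom\<close> unless they all vanish.
\<close>

lemma minimax_finite:
  fixes d :: "'i \<Rightarrow> 'k::topological_space \<Rightarrow> real" and b :: "'i \<Rightarrow> real"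
  assumes D: "compact D" "D \<noteq> {}" and J: "finite J"
    and cont: "\<And>i. i \<in> J \<Longrightarrow> continuous_on D (d i)"
    and conv: "\<And>k k' t. k \<in> D \<Longrightarrow> k' \<in> D \<Longrightarrow> 0 \<le> t \<Longrightarrow> t \<le> 1 \<Longrightarrow>
      \<exists>k''\<in>D. \<forall>i\<in>J. d i k'' = (1 - t) * d i k + t * d i k'"
    and dom: "\<And>w c. (\<And>i. i \<in> J \<Longrightarrow> 0 \<le> w i) \<Longrightarrow> (\<And>k. k \<in> D \<Longrightarrow> (\<Sum>i\<in>J. w i * d i k) \<le> c) \<Longrightarrow>
      (\<Sum>i\<in>J. w i * b i) \<le> c"
  shows "\<exists>k\<in>D. \<forall>i\<in>J. b i \<le> d i k"
proof -
  define F where "F = (\<lambda>k. \<Sum>i\<in>J. (max 0 (b i - d i k))\<^sup>2)"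
  have "continuous_on D F"
    unfolding F_def by (intro continuous_intros cont)
  then obtain k0 where k0: "k0 \<in> D" and min: "\<And>k. k \<in> D \<Longrightarrow> F k0 \<le> F k"
    using continuous_attains_inf[OF D] by blast
  define w where "w = (\<lambda>i. max 0 (b i - d i k0))"
  have "(\<Sum>i\<in>J. w i * d i k) \<le> (\<Sum>i\<in>J. w i * d i k0)" if k: "k \<in> D" for k
  proof -
    define h where "h = (\<lambda>i. d i k - d i k0)"
    define s where "s = (\<Sum>i\<in>J. w i * h i)"
    define r where "r = (\<Sum>i\<in>J. (h i)\<^sup>2)"
    \<comment> \<open>Minimality of \<open>F\<close> at \<open>k0\<close> is tested at the fraction
      \<open>t\<close> of the segment from \<open>k0\<close> to \<open>k\<close>. There
      \<open>F\<close> is at most \<open>F k0 - 2 * t * s + t\<^sup>2 * r\<close>, so for small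
      \<open>t\<close> a positive \<open>s\<close> would lower it.\<close>
    have first_order: "2 * s \<le> t * r" if t: "0 < t" "t \<le> 1" for t
    proof -
      obtain k' where k': "k' \<in> D" and dk': "\<And>i. i \<in> J \<Longrightarrow> d i k' = (1 - t) * d i k0 + t * d i k"
        using conv[OF k0 k less_imp_le[OF t(1)] t(2)] by blast
      have summand: "(max 0 (b i - d i k'))\<^sup>2 \<le> (w i)\<^sup>2 - 2 * t * (w i * h i) + t\<^sup>2 * (h i)\<^sup>2"
        if i: "i \<in> J" for i
      proof -
        have "b i - d i k' = (b i - d i k0) - t * h i"
          using dk'[OF i] by (simp add: h_def algebra_simps)
        \<comment> \<open>By \<open>max 0 (x - y) \<le> \<bar>max 0 x - y\<bar>\<close> the positive
          part is bounded by an expression polynomial in \<open>t\<close>.\<close>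
        then have "\<bar>max 0 (b i - d i k')\<bar> \<le> \<bar>w i - t * h i\<bar>"
          by (auto simp: w_def)
        then have "(max 0 (b i - d i k'))\<^sup>2 \<le> (w i - t * h i)\<^sup>2"
          by (simp only: abs_le_square_iff)
        then show ?thesis by (simp add: power2_eq_square algebra_simps)
      qed
      have "F k0 \<le> F k'" using min k' by blast
      also have "\<dots> \<le> (\<Sum>i\<in>J. (w i)\<^sup>2 - 2 * t * (w i * h i) + t\<^sup>2 * (h i)\<^sup>2)"
        unfolding F_def by (intro sum_mono summand)
      also have "\<dots> = F k0 - 2 * t * s + t\<^sup>2 * r"
        by (simp add: F_def w_def s_def r_def sum.distrib sum_subtractf sum_distrib_left)
      finally have "t * (2 * s) \<le> t * (t * r)" by (simp add: power2_eq_square algebra_simps)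
      then show ?thesis using t by simp
    qed
    have r: "0 \<le> r" by (simp add: r_def sum_nonneg)
    have "s \<le> 0"
    proof (rule ccontr)
      assume "\<not> s \<le> 0"
      then have s: "0 < s" by simp
      \<comment> \<open>Small enough for \<open>t * r \<le> s\<close>, which is incompatible with
        \<open>2 * s \<le> t * r\<close>; the summand 1 covers \<open>r = 0\<close>.\<close>
      define t where "t = min 1 (s / (r + 1))"
      have t: "0 < t" "t \<le> 1" "t \<le> s / (r + 1)" using s r by (auto simp: t_def)
      have "t * r \<le> s / (r + 1) * r" using t(3) r by (rule mult_right_mono)
      also have "\<dots> \<le> s" using s r by (simp add: field_simps)
      finally show False using first_order[OF t(1,2)] s by linarith
    qed
    then show ?thesis by (simp add: s_def h_def algebra_simps sum_subtractf)
  qed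
  \<comment> \<open>This is \<open>dom\<close> with \<open>c\<close> the weighted sum at
    \<open>k0\<close>, which has just been shown to be its maximum over \<open>D\<close>.\<close>
  then have "(\<Sum>i\<in>J. w i * b i) \<le> (\<Sum>i\<in>J. w i * d i k0)"
    by (intro dom) (auto simp: w_def)
  then have "(\<Sum>i\<in>J. w i * (b i - d i k0)) \<le> 0"
    by (simp add: algebra_simps sum_subtractf)
  \<comment> \<open>Where \<open>w i\<close> is nonzero it equals
    \<open>b i - d i k0\<close>.\<close>
  also have "(\<Sum>i\<in>J. w i * (b i - d i k0)) = (\<Sum>i\<in>J. (w i)\<^sup>2)"
    by (intro sum.cong refl) (auto simp: w_def max_def power2_eq_square)
  finally have "(\<Sum>i\<in>J. (w i)\<^sup>2) = 0" by (intro antisym sum_nonneg) auto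
  then have "w i = 0" if "i \<in> J" for i
    using J that by (simp add: sum_nonneg_eq_0_iff)
  then have "b i \<le> d i k0" if "i \<in> J" for i
    using that by (fastforce simp: w_def)
  then show ?thesis using k0 by blast
qed

text \<open>Each set \<open>{k. b i \<le> d i k}\<close> is closed, so the finite intersection
  property of \<open>D\<close> reduces the claim to finitely many indices. In \<open>dom\<close> the
  number \<open>c\<close> runs over upper bounds: the weighted sum of the \<open>b i\<close> must
  not exceed the supremum over \<open>D\<close> of the weighted sum of the \<open>d i\<close>,
  expressed without forming that supremum.\<close>

lemma minimax:
  fixes d :: "'i \<Rightarrow> 'k::topological_space \<Rightarrow> real" and b :: "'i \<Rightarrow> real"
  assumes D: "compact D" "D \<noteq> {}"
    and cont: "\<And>i. i \<in> I \<Longrightarrow> continuous_on UNIV (d i)"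
    and conv: "\<And>k k' t. k \<in> D \<Longrightarrow> k' \<in> D \<Longrightarrow> 0 \<le> t \<Longrightarrow> t \<le> 1 \<Longrightarrow>
      \<exists>k''\<in>D. \<forall>i\<in>I. d i k'' = (1 - t) * d i k + t * d i k'"
    and dom: "\<And>J w c. finite J \<Longrightarrow> J \<subseteq> I \<Longrightarrow> (\<And>i. i \<in> J \<Longrightarrow> 0 \<le> w i) \<Longrightarrow>
      (\<And>k. k \<in> D \<Longrightarrow> (\<Sum>i\<in>J. w i * d i k) \<le> c) \<Longrightarrow> (\<Sum>i\<in>J. w i * b i) \<le> c"
  shows "\<exists>k\<in>D. \<forall>i\<in>I. b i \<le> d i k"
proof -
  have "D \<inter> (\<Inter>i\<in>I. {k. b i \<le> d i k}) \<noteq> {}"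
  proof (rule compact_imp_fip_image[OF D(1)])
    show "closed {k. b i \<le> d i k}" if "i \<in> I" for i
      by (intro closed_Collect_le cont that continuous_intros)
  next
    fix J assume J: "finite J" "J \<subseteq> I"
    have "\<exists>k\<in>D. \<forall>i\<in>J. b i \<le> d i k"
    proof (rule minimax_finite[OF D J(1)])
      show "continuous_on D (d i)" if "i \<in> J" for i
        using cont J that by (blast intro: continuous_on_subset)
      show "\<exists>k''\<in>D. \<forall>i\<in>J. d i k'' = (1 - t) * d i k + t * d i k'"
        if "k \<in> D" "k' \<in> D" "0 \<le> t" "t \<le> 1" for k k' t
        using conv[OF that] J by blast
    qed (rule dom[OF J])
    then show "D \<inter> (\<Inter>i\<in>J. {k. b i \<le> d i k}) \<noteq> {}" by blast
  qed
  then show ?thesis by blast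
qed

section \<open>The Hilbert space of a positive semidefinite kernel\<close>

text \<open>
  A list of pairs \<open>(c, s)\<close> stands for the formal linear combination of the kernel functions
  \<open>q s\<close> with coefficients \<open>c\<close>.
\<close>

definition kernel_sum :: "('p \<Rightarrow> 'p \<Rightarrow> complex) \<Rightarrow> (complex \<times> 'p) list \<Rightarrow> 'p \<Rightarrow> complex" where
  "kernel_sum q a t = (\<Sum>(c, s)\<leftarrow>a. c * q s t)"

text \<open>The sesquilinear form in which \<open>q s\<close> and \<open>q t\<close> have inner
  product \<open>q s t\<close>. Lists may repeat points or represent the zero function, so even for
  a positive kernel it is only semidefinite.\<close>

definition kernel_form ::
  "('p \<Rightarrow> 'p \<Rightarrow> complex) \<Rightarrow> (complex \<times> 'p) list \<Rightarrow> (complex \<times> 'p) list \<Rightarrow> complex" where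
  "kernel_form q a b = (\<Sum>(d, t)\<leftarrow>b. cnj d * kernel_sum q a t)"

definition formal_scale :: "complex \<Rightarrow> (complex \<times> 'p) list \<Rightarrow> (complex \<times> 'p) list" where
  "formal_scale c a = map (\<lambda>(d, s). (c * d, s)) a"

abbreviation formal_diff :: "(complex \<times> 'p) list \<Rightarrow> (complex \<times> 'p) list \<Rightarrow> (complex \<times> 'p) list" where
  "formal_diff a b \<equiv> a @ formal_scale (- 1) b"

lemma kernel_sum_simps [simp]:
  "kernel_sum q [] t = 0"
  "kernel_sum q ((c, s) # a) t = c * q s t + kernel_sum q a t"
  "kernel_sum q (a @ b) t = kernel_sum q a t + kernel_sum q b t"
  by (simp_all add: kernel_sum_def)

lemma kernel_sum_scale [simp]: "kernel_sum q (formal_scale c a) t = c * kernel_sum q a t"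
  by (induction a) (auto simp: formal_scale_def algebra_simps)

lemma kernel_form_simps [simp]:
  "kernel_form q a [] = 0"
  "kernel_form q a ((d, t) # b) = cnj d * kernel_sum q a t + kernel_form q a b"
  "kernel_form q a (b @ b') = kernel_form q a b + kernel_form q a b'"
  by (simp_all add: kernel_form_def)

lemma kernel_form_left [simp]:
  "kernel_form q [] b = 0"
  "kernel_form q (a @ a') b = kernel_form q a b + kernel_form q a' b"
  "kernel_form q (formal_scale c a) b = c * kernel_form q a b"
  by (induction b) (auto simp: algebra_simps)

lemma kernel_form_scale_right [simp]: "kernel_form q a (formal_scale c b) = cnj c * kernel_form q a b"
  by (induction b) (auto simp: formal_scale_def algebra_simps)

lemma kernel_sum_eq_form: "kernel_sum q a t = kernel_form q a [(1, t)]"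
  by simp

text \<open>Positivity is demanded for all complex coefficients even if \<open>K = \<real>\<close>,
  so that Cauchy-Schwarz holds for arbitrary lists, with the scalar \<open>form a b\<close> as a
  coefficient. Coefficients are confined to \<open>K\<close> only in the Cauchy sequences of the
  completion.\<close>

locale psd_kernel =
  fixes K :: "complex set" and q :: "'p \<Rightarrow> 'p \<Rightarrow> complex"
  assumes K: "K = \<real> \<or> K = UNIV"
    and kernel_in: "q s t \<in> K"
    and kernel_cnj: "q t s = cnj (q s t)"
    and psd: "0 \<le> Re (kernel_form q a a)"
begin

abbreviation form where "form \<equiv> kernel_form q"
abbreviation ev where "ev \<equiv> kernel_sum q"

lemma K_add: "x \<in> K \<Longrightarrow> y \<in> K \<Longrightarrow> x + y \<in> K"
  and K_mult: "x \<in> K \<Longrightarrow> y \<in> K \<Longrightarrow> x * y \<in> K"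
  and K_cnj: "x \<in> K \<Longrightarrow> cnj x \<in> K"
  and K_closed: "closed K"
  and K_minus: "x \<in> K \<Longrightarrow> - x \<in> K"
  and K_one: "1 \<in> K" and K_zero: "0 \<in> K"
  using K by (auto simp: closed_complex_Reals Reals_cnj_iff)

lemma form_cnj: "form b a = cnj (form a b)"
proof -
  have 1: "form [(1, s)] b = cnj (ev b s)" for s b
    by (induction b) (auto simp: kernel_cnj[of s])
  have 2: "form ((c, s) # a) b = c * form [(1, s)] b + form a b" for c s a b
    by (induction b) (auto simp: algebra_simps)
  show ?thesis
  proof (induction a)
    case (Cons x a)
    obtain c s where x: "x = (c, s)" by (cases x)
    have "form ((c, s) # a) b = c * cnj (ev b s) + form a b" by (simp only: 2[of c s a b] 1)
    then show ?case by (simp add: x Cons.IH)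
  qed simp
qed

definition nrm where "nrm a = sqrt (Re (form a a))"

lemma nrm_nonneg: "0 \<le> nrm a"
  by (simp add: nrm_def psd)

lemma form_self: "form a a = of_real ((nrm a)\<^sup>2)"
  using form_cnj[of a a] by (simp add: nrm_def psd complex_eq_iff)

lemma nrm_scale: "nrm (formal_scale c a) = cmod c * nrm a"
proof -
  have "form (formal_scale c a) (formal_scale c a) = (c * cnj c) * form a a" by simp
  also have "\<dots> = of_real ((cmod c * nrm a)\<^sup>2)"
    by (simp add: form_self complex_norm_square[symmetric] power_mult_distrib)
  finally have "nrm (formal_scale c a) = sqrt ((cmod c * nrm a)\<^sup>2)" by (simp add: nrm_def)
  then show ?thesis by (simp add: nrm_nonneg)
qed

text \<open>The vector \<open>a - t * form a b * b\<close> has nonnegative square for every real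
  \<open>t\<close>, and this square is a quadratic polynomial in \<open>t\<close>. If
  \<open>nrm b > 0\<close>, take its minimiser, the reciprocal of \<open>(nrm b)\<^sup>2\<close>. As
  the form is only semidefinite, \<open>nrm b = 0\<close> is a separate case: the polynomial is then
  affine, hence constant.\<close>

lemma form_Cauchy_Schwarz: "cmod (form a b) \<le> nrm a * nrm b"
proof -
  define B where "B = (cmod (form a b))\<^sup>2"
  have ineq: "0 \<le> (nrm a)\<^sup>2 - 2 * t * B + t\<^sup>2 * (B * (nrm b)\<^sup>2)" for t :: real
  proof -
    define z where "z = formal_diff a (formal_scale (of_real t * form a b) b)"
    have "form z z = of_real ((nrm a)\<^sup>2 - 2 * t * B + t\<^sup>2 * (B * (nrm b)\<^sup>2))"
      unfolding z_def using complex_norm_square[of "form a b"]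
      by (simp add: form_cnj[of b a] form_self B_def algebra_simps power2_eq_square)
    then show ?thesis using psd[of z] by simp
  qed
  have "B \<le> (nrm a)\<^sup>2 * (nrm b)\<^sup>2"
  proof (cases "nrm b = 0")
    case True
    have "B = 0"
    proof (rule ccontr)
      assume "B \<noteq> 0"
      then have "B > 0" by (simp add: B_def)
      \<comment> \<open>This value of \<open>t\<close> makes the affine polynomial negative, equal
        to \<open>- (nrm a)\<^sup>2 - 2\<close>.\<close>
      then have "2 * (((nrm a)\<^sup>2 + 1) / B) * B = 2 * (nrm a)\<^sup>2 + 2" by simp
      then have "0 \<le> (nrm a)\<^sup>2 - (2 * (nrm a)\<^sup>2 + 2)"
        using ineq[of "((nrm a)\<^sup>2 + 1) / B"] True by (simp only:) simp
      then show False using zero_le_power2[of "nrm a"] by linarith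
    qed
    then show ?thesis by simp
  next
    case False
    define C where "C = (nrm b)\<^sup>2"
    have C: "C > 0" using False by (simp add: C_def)
    have "(1 / C)\<^sup>2 * (B * C) = B / C" using C by (simp add: power2_eq_square)
    then have "B / C \<le> (nrm a)\<^sup>2" using ineq[of "1 / C"] by (simp add: C_def)
    then show ?thesis using C by (simp add: C_def[symmetric] field_simps)
  qed
  then have "(cmod (form a b))\<^sup>2 \<le> (nrm a * nrm b)\<^sup>2" by (simp add: B_def power_mult_distrib)
  then show ?thesis by (rule power2_le_imp_le) (simp add: nrm_nonneg)
qed

lemma nrm_append: "nrm (a @ b) \<le> nrm a + nrm b"
proof -
  have "(nrm (a @ b))\<^sup>2 = Re (form (a @ b) (a @ b))" by (simp only: form_self) simp
  also have "\<dots> = (nrm a)\<^sup>2 + (nrm b)\<^sup>2 + 2 * Re (form a b)"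
    by (simp add: form_self form_cnj[of b a])
  also have "\<dots> \<le> (nrm a)\<^sup>2 + (nrm b)\<^sup>2 + 2 * (nrm a * nrm b)"
    using complex_Re_le_cmod[of "form a b"] form_Cauchy_Schwarz[of a b] by simp
  also have "\<dots> = (nrm a + nrm b)\<^sup>2" by (simp add: power2_eq_square algebra_simps)
  finally show ?thesis by (rule power2_le_imp_le) (simp add: nrm_nonneg)
qed

text \<open>The form sees a list only through the function it defines: directly on the left, and by
  conjugate symmetry on the right. Rearrangements and cancellations of lists can therefore be
  checked pointwise.\<close>

lemma nrm_cong: "(\<And>t. ev a t = ev b t) \<Longrightarrow> nrm a = nrm b"
proof -
  assume e: "\<And>t. ev a t = ev b t"
  have *: "form a c = form b c" for c by (induction c) (auto simp: e)
  have "form a a = form b b" using *[of a] *[of b] form_cnj[of b a] form_cnj[of b b] by simp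
  then show ?thesis by (simp add: nrm_def)
qed

lemma nrm_diff_commute: "nrm (formal_diff a b) = nrm (formal_diff b a)"
proof -
  have "nrm (formal_diff a b) = nrm (formal_scale (-1) (formal_diff b a))" by (rule nrm_cong) simp
  then show ?thesis by (simp add: nrm_scale)
qed

lemma nrm_diff_self [simp]: "nrm (formal_diff a a) = 0"
proof -
  have "nrm (formal_diff a a) = nrm []" by (rule nrm_cong) simp
  then show ?thesis by (simp add: nrm_def)
qed

lemma nrm_diff_ge: "\<bar>nrm a - nrm b\<bar> \<le> nrm (formal_diff a b)"
proof -
  have "nrm a = nrm (formal_diff a b @ b)" "nrm b = nrm (formal_diff b a @ a)" by (rule nrm_cong, simp)+
  then show ?thesis using nrm_append[of "formal_diff a b" b] nrm_append[of "formal_diff b a" a] nrm_diff_commute[of a b]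
    by linarith
qed

section \<open>Cauchy sequences of formal combinations and their limits\<close>

definition Kcauchy :: "(nat \<Rightarrow> (complex \<times> 'p) list) \<Rightarrow> bool" where
  "Kcauchy \<alpha> \<longleftrightarrow> (\<forall>n. \<alpha> n \<in> lists (K \<times> UNIV)) \<and>
     (\<forall>e>0. \<exists>N. \<forall>m\<ge>N. \<forall>n\<ge>N. nrm (formal_diff (\<alpha> m) (\<alpha> n)) < e)"

lemma KcauchyD: "Kcauchy \<alpha> \<Longrightarrow> e > 0 \<Longrightarrow> \<exists>N. \<forall>m\<ge>N. \<forall>n\<ge>N. nrm (formal_diff (\<alpha> m) (\<alpha> n)) < e"
  by (simp add: Kcauchy_def)

lemma Kcauchy_const: "a \<in> lists (K \<times> UNIV) \<Longrightarrow> Kcauchy (\<lambda>n. a)"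
  by (simp add: Kcauchy_def)

lemma scale_lists: "c \<in> K \<Longrightarrow> a \<in> lists (K \<times> UNIV) \<Longrightarrow> formal_scale c a \<in> lists (K \<times> UNIV)"
  by (auto simp: formal_scale_def in_lists_conv_set K_mult)

lemma Kcauchy_append:
  assumes "Kcauchy \<alpha>" "Kcauchy \<beta>"
  shows "Kcauchy (\<lambda>n. \<alpha> n @ \<beta> n)"
  unfolding Kcauchy_def
proof (intro conjI allI impI)
  show "\<alpha> n @ \<beta> n \<in> lists (K \<times> UNIV)" for n using assms by (simp add: Kcauchy_def)
  fix e :: real assume e: "e > 0"
  obtain N where N: "\<forall>m\<ge>N. \<forall>n\<ge>N. nrm (formal_diff (\<alpha> m) (\<alpha> n)) < e / 2"
    using KcauchyD[OF assms(1), of "e / 2"] e by auto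
  obtain N' where N': "\<forall>m\<ge>N'. \<forall>n\<ge>N'. nrm (formal_diff (\<beta> m) (\<beta> n)) < e / 2"
    using KcauchyD[OF assms(2), of "e / 2"] e by auto
  have "nrm (formal_diff (\<alpha> m @ \<beta> m) (\<alpha> n @ \<beta> n)) < e" if "m \<ge> max N N'" "n \<ge> max N N'" for m n
  proof -
    have "nrm (formal_diff (\<alpha> m @ \<beta> m) (\<alpha> n @ \<beta> n)) = nrm (formal_diff (\<alpha> m) (\<alpha> n) @ formal_diff (\<beta> m) (\<beta> n))"
      by (rule nrm_cong) (simp add: algebra_simps)
    also have "\<dots> \<le> nrm (formal_diff (\<alpha> m) (\<alpha> n)) + nrm (formal_diff (\<beta> m) (\<beta> n))" by (rule nrm_append)
    also have "\<dots> < e / 2 + e / 2" using that N N' by (intro add_strict_mono) auto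
    finally show ?thesis by simp
  qed
  then show "\<exists>N. \<forall>m\<ge>N. \<forall>n\<ge>N. nrm (formal_diff (\<alpha> m @ \<beta> m) (\<alpha> n @ \<beta> n)) < e" by blast
qed

lemma Kcauchy_scale:
  assumes "Kcauchy \<alpha>" "c \<in> K"
  shows "Kcauchy (\<lambda>n. formal_scale c (\<alpha> n))"
  unfolding Kcauchy_def
proof (intro conjI allI impI)
  show "formal_scale c (\<alpha> n) \<in> lists (K \<times> UNIV)" for n
    using assms by (intro scale_lists) (simp_all add: Kcauchy_def)
  fix e :: real assume e: "e > 0"
  then have e': "e / (cmod c + 1) > 0" by (intro divide_pos_pos) (auto intro: add_nonneg_pos)
  obtain N where N: "\<forall>m\<ge>N. \<forall>n\<ge>N. nrm (formal_diff (\<alpha> m) (\<alpha> n)) < e / (cmod c + 1)"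
    using KcauchyD[OF assms(1) e'] by auto
  have "nrm (formal_diff (formal_scale c (\<alpha> m)) (formal_scale c (\<alpha> n))) < e" if "m \<ge> N" "n \<ge> N" for m n
  proof -
    have "nrm (formal_diff (formal_scale c (\<alpha> m)) (formal_scale c (\<alpha> n))) = nrm (formal_scale c (formal_diff (\<alpha> m) (\<alpha> n)))"
      by (rule nrm_cong) (simp add: algebra_simps)
    also have "\<dots> \<le> (cmod c + 1) * nrm (formal_diff (\<alpha> m) (\<alpha> n))"
      by (simp add: nrm_scale nrm_nonneg mult_right_mono)
    also have "\<dots> < (cmod c + 1) * (e / (cmod c + 1))"
      using N that by (intro mult_strict_left_mono) (auto intro: add_nonneg_pos)
    also have "\<dots> = e" using norm_ge_zero[of c] by (simp add: field_simps add_nonneg_eq_0_iff)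
    finally show ?thesis .
  qed
  then show "\<exists>N. \<forall>m\<ge>N. \<forall>n\<ge>N. nrm (formal_diff (formal_scale c (\<alpha> m)) (formal_scale c (\<alpha> n))) < e" by blast
qed

lemma Kcauchy_diff: "Kcauchy \<alpha> \<Longrightarrow> Kcauchy \<beta> \<Longrightarrow> Kcauchy (\<lambda>n. formal_diff (\<alpha> n) (\<beta> n))"
  by (intro Kcauchy_append Kcauchy_scale K_minus K_one)

lemma Kcauchy_bounded:
  assumes "Kcauchy \<alpha>"
  obtains B where "B > 0" "\<And>n. nrm (\<alpha> n) \<le> B"
proof -
  have "Cauchy (\<lambda>n. nrm (\<alpha> n))"
  proof (rule metric_CauchyI)
    fix e :: real assume "e > 0"
    then show "\<exists>N. \<forall>m\<ge>N. \<forall>n\<ge>N. dist (nrm (\<alpha> m)) (nrm (\<alpha> n)) < e"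
      using KcauchyD[OF assms] nrm_diff_ge unfolding dist_real_def by (meson le_less_trans)
  qed
  then have "Bseq (\<lambda>n. nrm (\<alpha> n))" by (rule Cauchy_Bseq)
  then show thesis using that by (auto simp: Bseq_def nrm_nonneg)
qed

lemma form_convergent:
  assumes \<alpha>: "Kcauchy \<alpha>" and \<beta>: "Kcauchy \<beta>"
  shows "convergent (\<lambda>n. form (\<alpha> n) (\<beta> n))"
proof -
  obtain A where A: "A > 0" "\<And>n. nrm (\<alpha> n) \<le> A" by (rule Kcauchy_bounded[OF \<alpha>]) blast
  obtain B where B: "B > 0" "\<And>n. nrm (\<beta> n) \<le> B" by (rule Kcauchy_bounded[OF \<beta>]) blast
  have "Cauchy (\<lambda>n. form (\<alpha> n) (\<beta> n))"
  proof (rule metric_CauchyI)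
    fix e :: real assume e: "e > 0"
    obtain N where N: "\<forall>m\<ge>N. \<forall>n\<ge>N. nrm (formal_diff (\<alpha> m) (\<alpha> n)) < e / (2 * B)"
      using KcauchyD[OF \<alpha>, of "e / (2 * B)"] e B by auto
    obtain N' where N': "\<forall>m\<ge>N'. \<forall>n\<ge>N'. nrm (formal_diff (\<beta> m) (\<beta> n)) < e / (2 * A)"
      using KcauchyD[OF \<beta>, of "e / (2 * A)"] e A by auto
    have "dist (form (\<alpha> m) (\<beta> m)) (form (\<alpha> n) (\<beta> n)) < e"
      if mn: "m \<ge> max N N'" "n \<ge> max N N'" for m n
    proof -
      have "dist (form (\<alpha> m) (\<beta> m)) (form (\<alpha> n) (\<beta> n)) =
          cmod (form (formal_diff (\<alpha> m) (\<alpha> n)) (\<beta> m) + form (\<alpha> n) (formal_diff (\<beta> m) (\<beta> n)))"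
        by (simp add: dist_norm)
      also have "\<dots> \<le> nrm (formal_diff (\<alpha> m) (\<alpha> n)) * nrm (\<beta> m) + nrm (\<alpha> n) * nrm (formal_diff (\<beta> m) (\<beta> n))"
        by (intro norm_triangle_le add_mono form_Cauchy_Schwarz)
      also have "\<dots> \<le> nrm (formal_diff (\<alpha> m) (\<alpha> n)) * B + A * nrm (formal_diff (\<beta> m) (\<beta> n))"
        by (intro add_mono mult_mono A B nrm_nonneg order_refl) (use A in simp)
      also have "\<dots> < e / (2 * B) * B + A * (e / (2 * A))"
        using N N' mn A B by (intro add_strict_mono mult_strict_right_mono mult_strict_left_mono) auto
      also have "\<dots> = e" using A B by simp
      finally show ?thesis .
    qed
    then show "\<exists>N. \<forall>m\<ge>N. \<forall>n\<ge>N. dist (form (\<alpha> m) (\<beta> m)) (form (\<alpha> n) (\<beta> n)) < e" by blast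
  qed
  then show ?thesis by (simp add: Cauchy_convergent_iff)
qed

definition lform where "lform \<alpha> \<beta> = lim (\<lambda>n. form (\<alpha> n) (\<beta> n))"

lemma form_tendsto: "Kcauchy \<alpha> \<Longrightarrow> Kcauchy \<beta> \<Longrightarrow> (\<lambda>n. form (\<alpha> n) (\<beta> n)) \<longlonglongrightarrow> lform \<alpha> \<beta>"
  using form_convergent by (simp add: lform_def convergent_LIMSEQ_iff)

text \<open>
  The completion is realised by functions: a Cauchy sequence of formal combinations is
  represented by the pointwise limit of the functions they define.
\<close>

definition limfun :: "(nat \<Rightarrow> (complex \<times> 'p) list) \<Rightarrow> 'p \<Rightarrow> complex" where
  "limfun \<alpha> t = lim (\<lambda>n. ev (\<alpha> n) t)"

text \<open>Evaluation at \<open>t\<close> is the form against the one-term list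
  \<open>[(1, t)]\<close>, so convergence of the form gives pointwise convergence.\<close>

lemma ev_tendsto:
  assumes "Kcauchy \<alpha>"
  shows "(\<lambda>n. ev (\<alpha> n) t) \<longlonglongrightarrow> limfun \<alpha> t"
proof -
  have "convergent (\<lambda>n. ev (\<alpha> n) t)"
    using form_convergent[OF assms Kcauchy_const[of "[(1, t)]"]] by (simp add: K_one)
  then show ?thesis by (simp add: limfun_def convergent_LIMSEQ_iff)
qed

lemma limfun_eqI: "(\<And>t. (\<lambda>n. ev (\<alpha> n) t) \<longlonglongrightarrow> f t) \<Longrightarrow> limfun \<alpha> = f"
  by (auto simp: limfun_def limI)

lemma limfun_append:
  "Kcauchy \<alpha> \<Longrightarrow> Kcauchy \<beta> \<Longrightarrow> limfun (\<lambda>n. \<alpha> n @ \<beta> n) = (\<lambda>t. limfun \<alpha> t + limfun \<beta> t)"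
  by (intro limfun_eqI) (simp add: tendsto_add ev_tendsto)

lemma limfun_scale: "Kcauchy \<alpha> \<Longrightarrow> limfun (\<lambda>n. formal_scale c (\<alpha> n)) = (\<lambda>t. c * limfun \<alpha> t)"
  by (intro limfun_eqI) (simp add: tendsto_mult_left ev_tendsto)

lemma limfun_diff:
  assumes "Kcauchy \<alpha>" "Kcauchy \<beta>"
  shows "limfun (\<lambda>n. formal_diff (\<alpha> n) (\<beta> n)) = (\<lambda>t. limfun \<alpha> t - limfun \<beta> t)"
  using assms limfun_append[OF assms(1) Kcauchy_scale[OF assms(2), of "-1"]]
  by (simp add: limfun_scale K_minus K_one)

lemma limfun_const: "limfun (\<lambda>n. [(1, s)]) = q s"
  by (rule limfun_eqI) simp

text \<open>This makes the passage to functions faithful: a Cauchy sequence with pointwise limit 0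
  is null for the form, so \<open>lform\<close> depends on the limit functions alone. Against a
  fixed list the form is a finite combination of point values and tends to 0; replacing
  \<open>\<beta> n\<close> by a fixed \<open>\<beta> N\<close> costs little, because the sequence
  \<open>\<gamma>\<close> is bounded.\<close>

lemma form_tendsto_0:
  assumes \<gamma>: "Kcauchy \<gamma>" and \<beta>: "Kcauchy \<beta>" and 0: "limfun \<gamma> = (\<lambda>t. 0)"
  shows "(\<lambda>n. form (\<gamma> n) (\<beta> n)) \<longlonglongrightarrow> 0"
proof (rule LIMSEQ_I)
  fix e :: real assume e: "e > 0"
  have lim: "(\<lambda>n. form (\<gamma> n) b) \<longlonglongrightarrow> 0" for b
  proof (induction b)
    case (Cons x b)
    obtain d t where x: "x = (d, t)" by (cases x)
    have "(\<lambda>n. cnj d * ev (\<gamma> n) t + form (\<gamma> n) b) \<longlonglongrightarrow> cnj d * 0 + 0"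
      using ev_tendsto[OF \<gamma>, of t] Cons.IH 0 by (intro tendsto_intros) auto
    then show ?case by (simp add: x)
  qed simp
  obtain A where A: "A > 0" "\<And>n. nrm (\<gamma> n) \<le> A" by (rule Kcauchy_bounded[OF \<gamma>]) blast
  obtain N where N: "\<forall>m\<ge>N. \<forall>n\<ge>N. nrm (formal_diff (\<beta> m) (\<beta> n)) < e / (2 * A)"
    using KcauchyD[OF \<beta>, of "e / (2 * A)"] e A by auto
  obtain N' where N': "\<forall>n\<ge>N'. cmod (form (\<gamma> n) (\<beta> N)) < e / 2"
    using LIMSEQ_D[OF lim, of "e / 2" "\<beta> N"] e by auto
  have "norm (form (\<gamma> n) (\<beta> n) - 0) < e" if n: "n \<ge> max N N'" for n
  proof -
    have "form (\<gamma> n) (\<beta> n) = form (\<gamma> n) (formal_diff (\<beta> n) (\<beta> N)) + form (\<gamma> n) (\<beta> N)" by simp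
    then have "cmod (form (\<gamma> n) (\<beta> n)) \<le> nrm (\<gamma> n) * nrm (formal_diff (\<beta> n) (\<beta> N)) + cmod (form (\<gamma> n) (\<beta> N))"
      by (metis add_mono form_Cauchy_Schwarz norm_triangle_le order_refl)
    also have "\<dots> \<le> A * nrm (formal_diff (\<beta> n) (\<beta> N)) + cmod (form (\<gamma> n) (\<beta> N))"
      by (intro add_mono mult_mono A nrm_nonneg order_refl) (use A in simp)
    also have "\<dots> < A * (e / (2 * A)) + e / 2"
      using N N' n A by (intro add_strict_mono mult_strict_left_mono) auto
    finally show ?thesis using A by simp
  qed
  then show "\<exists>N. \<forall>n\<ge>N. norm (form (\<gamma> n) (\<beta> n) - 0) < e" by blast
qed

lemma lform_cong_left:
  assumes "Kcauchy \<alpha>" "Kcauchy \<alpha>'" "Kcauchy \<beta>" "limfun \<alpha> = limfun \<alpha>'"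
  shows "lform \<alpha> \<beta> = lform \<alpha>' \<beta>"
proof -
  have "(\<lambda>n. form (formal_diff (\<alpha> n) (\<alpha>' n)) (\<beta> n)) \<longlonglongrightarrow> 0"
    using assms by (intro form_tendsto_0 Kcauchy_diff) (simp_all add: limfun_diff)
  then have "(\<lambda>n. form (\<alpha> n) (\<beta> n) - form (\<alpha>' n) (\<beta> n)) \<longlonglongrightarrow> 0" by simp
  moreover have "(\<lambda>n. form (\<alpha> n) (\<beta> n) - form (\<alpha>' n) (\<beta> n)) \<longlonglongrightarrow> lform \<alpha> \<beta> - lform \<alpha>' \<beta>"
    using assms by (intro tendsto_diff form_tendsto)
  ultimately show ?thesis using LIMSEQ_unique by fastforce
qed

lemma lform_cnj: "Kcauchy \<alpha> \<Longrightarrow> Kcauchy \<beta> \<Longrightarrow> lform \<beta> \<alpha> = cnj (lform \<alpha> \<beta>)"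
  using tendsto_cnj[OF form_tendsto[of \<alpha> \<beta>]] form_tendsto[of \<beta> \<alpha>]
  by (simp add: form_cnj[symmetric] LIMSEQ_unique)

lemma lform_cong:
  assumes "Kcauchy \<alpha>" "Kcauchy \<alpha>'" "Kcauchy \<beta>" "Kcauchy \<beta>'" "limfun \<alpha> = limfun \<alpha>'" "limfun \<beta> = limfun \<beta>'"
  shows "lform \<alpha> \<beta> = lform \<alpha>' \<beta>'"
  using lform_cong_left[OF assms(1,2,3,5)] lform_cong_left[OF assms(3,4,2,6)]
    lform_cnj[OF assms(2,3)] lform_cnj[OF assms(2,4)] by (metis complex_cnj_cnj)

section \<open>The completion as a Hilbert space of functions\<close>

definition rep :: "('p \<Rightarrow> complex) \<Rightarrow> nat \<Rightarrow> (complex \<times> 'p) list" where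
  "rep f = (SOME \<alpha>. Kcauchy \<alpha> \<and> limfun \<alpha> = f)"

text \<open>The Moore-Aronszajn space of \<open>q\<close>. Pointwise operations turn the module laws
  into identities of functions, and no quotient by null vectors has to be taken. The choice made by
  \<open>rep\<close> does not affect the inner product, by \<open>lform_cong\<close>.\<close>

definition rkhs :: "('p \<Rightarrow> complex) ipspace" where
  "rkhs = \<lparr>carrier = limfun ` Collect Kcauchy, mult = (\<lambda>f g. f), one = (\<lambda>t. 0), zero = (\<lambda>t. 0),
     add = (\<lambda>f g t. f t + g t), smult = (\<lambda>c f t. c * f t),
     vnorm = (\<lambda>f. sqrt (Re (lform (rep f) (rep f)))), ip = (\<lambda>f g. lform (rep f) (rep g))\<rparr>"

lemma rkhs_simps [simp]:
  "carrier rkhs = limfun ` Collect Kcauchy" "zero rkhs = (\<lambda>t. 0)"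
  "add rkhs = (\<lambda>f g t. f t + g t)" "smult rkhs = (\<lambda>c f t. c * f t)"
  by (simp_all add: rkhs_def)

lemma rep: "Kcauchy \<alpha> \<Longrightarrow> Kcauchy (rep (limfun \<alpha>)) \<and> limfun (rep (limfun \<alpha>)) = limfun \<alpha>"
  unfolding rep_def by (rule someI[of _ \<alpha>]) simp

lemma rkhs_ip: "Kcauchy \<alpha> \<Longrightarrow> Kcauchy \<beta> \<Longrightarrow> ip rkhs (limfun \<alpha>) (limfun \<beta>) = lform \<alpha> \<beta>"
  using rep[of \<alpha>] rep[of \<beta>] lform_cong[of "rep (limfun \<alpha>)" \<alpha> "rep (limfun \<beta>)" \<beta>]
  by (simp add: rkhs_def)

lemma rkhs_vnorm_eq: "vnorm rkhs f = sqrt (Re (ip rkhs f f))"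
  by (simp add: rkhs_def)

lemma rkhs_vnorm_tendsto:
  assumes "Kcauchy \<alpha>"
  shows "(\<lambda>n. nrm (\<alpha> n)) \<longlonglongrightarrow> vnorm rkhs (limfun \<alpha>)"
  unfolding rkhs_vnorm_eq rkhs_ip[OF assms assms] nrm_def
  by (intro tendsto_real_sqrt tendsto_Re form_tendsto assms)

lemma limfun_zero: "limfun (\<lambda>n. []) = (\<lambda>t. 0)" and Kcauchy_zero: "Kcauchy (\<lambda>n. [])"
  by (rule limfun_eqI, simp) (simp add: Kcauchy_const)

lemma rkhs_module: "Module.module (scalars K) rkhs"
proof -
  have sc: "carrier (scalars K) = K" "add (scalars K) = (+)" "mult (scalars K) = (*)"
    "one (scalars K) = 1" "zero (scalars K) = 0"
    by (simp_all add: scalars_def)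
  have ring: "cring (scalars K)"
  proof (rule cringI)
    show "abelian_group (scalars K)"
    proof (rule abelian_groupI)
      fix x assume "x \<in> carrier (scalars K)"
      then show "\<exists>y\<in>carrier (scalars K). y \<oplus>\<^bsub>scalars K\<^esub> x = \<zero>\<^bsub>scalars K\<^esub>"
        by (intro bexI[of _ "- x"]) (simp_all add: sc K_minus)
    qed (simp_all add: sc K_add K_zero)
    show "Group.comm_monoid (scalars K)"
      by (rule comm_monoidI) (simp_all add: sc K_mult K_one)
  qed (simp add: sc distrib_right)
  have "abelian_group rkhs"
  proof (rule abelian_groupI)
    fix f g assume "f \<in> carrier rkhs" "g \<in> carrier rkhs"
    then obtain \<alpha> \<beta> where "Kcauchy \<alpha>" "f = limfun \<alpha>" "Kcauchy \<beta>" "g = limfun \<beta>" by auto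
    then show "f \<oplus>\<^bsub>rkhs\<^esub> g \<in> carrier rkhs"
      using limfun_append[of \<alpha> \<beta>, symmetric] Kcauchy_append[of \<alpha> \<beta>] by simp
  next
    show "\<zero>\<^bsub>rkhs\<^esub> \<in> carrier rkhs"
      using Kcauchy_zero limfun_zero[symmetric] by simp
  next
    fix f assume "f \<in> carrier rkhs"
    then obtain \<alpha> where \<alpha>: "Kcauchy \<alpha>" "f = limfun \<alpha>" by auto
    then have "limfun (\<lambda>n. formal_scale (-1) (\<alpha> n)) \<in> carrier rkhs"
      using Kcauchy_scale[OF \<alpha>(1), of "-1"] by (simp add: K_minus K_one)
    then show "\<exists>g\<in>carrier rkhs. g \<oplus>\<^bsub>rkhs\<^esub> f = \<zero>\<^bsub>rkhs\<^esub>"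
      by (rule rev_bexI) (simp add: limfun_scale \<alpha>)
  qed (auto simp: algebra_simps)
  then show ?thesis
  proof (rule moduleI[OF ring])
    fix c f assume "c \<in> carrier (scalars K)" "f \<in> carrier rkhs"
    then obtain \<alpha> where "Kcauchy \<alpha>" "f = limfun \<alpha>" "c \<in> K" by (auto simp: sc)
    then show "c \<odot>\<^bsub>rkhs\<^esub> f \<in> carrier rkhs"
      using Kcauchy_scale[of \<alpha> c] limfun_scale[of \<alpha> c, symmetric] by simp
  qed (auto simp: sc algebra_simps)
qed

lemma rkhs_normed_space: "normed_space K rkhs"
proof (intro normed_space.intro rkhs_module normed_space_axioms.intro)
  fix f assume "f \<in> carrier rkhs"
  then obtain \<alpha> where \<alpha>: "Kcauchy \<alpha>" "f = limfun \<alpha>" by auto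
  note lim = rkhs_vnorm_tendsto[OF \<alpha>(1), folded \<alpha>(2)]
  show "0 \<le> vnorm rkhs f"
    using lim by (rule LIMSEQ_le_const) (simp add: nrm_nonneg)
  show "vnorm rkhs f = 0 \<longleftrightarrow> f = \<zero>\<^bsub>rkhs\<^esub>"
  proof
    assume "vnorm rkhs f = 0"
    \<comment> \<open>Definiteness: point values are bounded by the norm of \<open>f\<close> times
      the norm of the kernel function at \<open>t\<close>, so a vector of norm 0 is the zero
      function.\<close>
    then have "(\<lambda>n. nrm (\<alpha> n) * nrm [(1, t)]) \<longlonglongrightarrow> 0" for t
      using tendsto_mult_right[OF lim, of "nrm [(1, t)]"] by simp
    moreover have "\<forall>\<^sub>F n in sequentially. cmod (ev (\<alpha> n) t) \<le> nrm (\<alpha> n) * nrm [(1, t)]" for t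
      by (simp only: kernel_sum_eq_form form_Cauchy_Schwarz eventually_True)
    ultimately have "(\<lambda>n. ev (\<alpha> n) t) \<longlonglongrightarrow> 0" for t
      by (rule Lim_null_comparison[rotated])
    then show "f = \<zero>\<^bsub>rkhs\<^esub>" unfolding \<alpha> by (simp add: limfun_eqI)
  next
    assume "f = \<zero>\<^bsub>rkhs\<^esub>"
    then have "(\<lambda>n. nrm []) \<longlonglongrightarrow> vnorm rkhs f"
      using rkhs_vnorm_tendsto[OF Kcauchy_zero] by (simp add: limfun_zero)
    then show "vnorm rkhs f = 0" by (simp add: nrm_def LIMSEQ_const_iff)
  qed
  fix c assume c: "c \<in> K"
  have "(\<lambda>n. cmod c * nrm (\<alpha> n)) \<longlonglongrightarrow> vnorm rkhs (\<lambda>t. c * f t)"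
    using rkhs_vnorm_tendsto[OF Kcauchy_scale[OF \<alpha>(1) c]] by (simp add: nrm_scale limfun_scale \<alpha>)
  then show "vnorm rkhs (c \<odot>\<^bsub>rkhs\<^esub> f) = cmod c * vnorm rkhs f"
    using LIMSEQ_unique[OF _ tendsto_mult_left[OF lim]] by simp
next
  fix f g assume "f \<in> carrier rkhs" "g \<in> carrier rkhs"
  then obtain \<alpha> \<beta> where \<alpha>: "Kcauchy \<alpha>" "f = limfun \<alpha>" "Kcauchy \<beta>" "g = limfun \<beta>" by auto
  have "(\<lambda>n. nrm (\<alpha> n @ \<beta> n)) \<longlonglongrightarrow> vnorm rkhs (f \<oplus>\<^bsub>rkhs\<^esub> g)"
    using rkhs_vnorm_tendsto[OF Kcauchy_append[OF \<alpha>(1,3)]] by (simp add: limfun_append \<alpha>)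
  moreover have "(\<lambda>n. nrm (\<alpha> n) + nrm (\<beta> n)) \<longlonglongrightarrow> vnorm rkhs f + vnorm rkhs g"
    unfolding \<alpha> by (intro tendsto_add rkhs_vnorm_tendsto \<alpha>)
  ultimately show "vnorm rkhs (f \<oplus>\<^bsub>rkhs\<^esub> g) \<le> vnorm rkhs f + vnorm rkhs g"
    by (rule LIMSEQ_le) (auto simp: nrm_append)
qed

lemma rkhs_minus:
  assumes "f \<in> carrier rkhs" "g \<in> carrier rkhs"
  shows "f \<ominus>\<^bsub>rkhs\<^esub> g = (\<lambda>t. f t - g t)"
proof -
  interpret normed_space K rkhs by (rule rkhs_normed_space)
  have "\<ominus>\<^bsub>rkhs\<^esub> g \<oplus>\<^bsub>rkhs\<^esub> g = \<zero>\<^bsub>rkhs\<^esub>" by (rule M.l_neg[OF assms(2)])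
  then have "(\<ominus>\<^bsub>rkhs\<^esub> g) t + g t = 0" for t by (simp add: fun_eq_iff)
  then have "(\<ominus>\<^bsub>rkhs\<^esub> g) t = - g t" for t by (simp add: eq_neg_iff_add_eq_0)
  then show ?thesis by (simp add: a_minus_def)
qed

lemma rkhs_vdist_tendsto:
  assumes "Kcauchy \<alpha>" "Kcauchy \<beta>"
  shows "(\<lambda>n. nrm (formal_diff (\<alpha> n) (\<beta> n))) \<longlonglongrightarrow> vdist rkhs (limfun \<alpha>) (limfun \<beta>)"
  using rkhs_vnorm_tendsto[OF Kcauchy_diff[OF assms]] assms
  by (simp add: vdist_def rkhs_minus limfun_diff)

text \<open>A diagonal choice: each \<open>\<sigma> k\<close> is approximated within
  \<open>1 / Suc k\<close> by a single list \<open>b k\<close>, whose function is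
  \<open>J k\<close>. The lists \<open>b k\<close> then form a Cauchy sequence themselves, and the
  function it defines is the limit of \<open>\<sigma>\<close>.\<close>

lemma rkhs_complete: "Metric_space.mcomplete (carrier rkhs) (vdist rkhs)"
proof -
  interpret normed_space K rkhs by (rule rkhs_normed_space)
  interpret m: Metric_space "carrier rkhs" "vdist rkhs" by (rule Metric_space_vdist)
  show ?thesis
    unfolding m.mcomplete_def
  proof (intro allI impI)
    fix \<sigma> assume c: "m.MCauchy \<sigma>"
    then have "range \<sigma> \<subseteq> limfun ` Collect Kcauchy"
      unfolding m.MCauchy_def by simp
    then have "\<exists>\<alpha>. Kcauchy \<alpha> \<and> \<sigma> k = limfun \<alpha>" for k
      using rangeI[of \<sigma> k] by blast
    then obtain \<alpha> where \<alpha>: "\<And>k. Kcauchy (\<alpha> k)" "\<And>k. \<sigma> k = limfun (\<alpha> k)" by metis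
    have "\<exists>N. \<forall>m\<ge>N. \<forall>n\<ge>N. nrm (formal_diff (\<alpha> k m) (\<alpha> k n)) < 1 / Suc k" for k
      using KcauchyD[OF \<alpha>(1), of "1 / Suc k"] by simp
    then obtain N where N: "\<And>k m n. m \<ge> N k \<Longrightarrow> n \<ge> N k \<Longrightarrow> nrm (formal_diff (\<alpha> k m) (\<alpha> k n)) < 1 / Suc k"
      by metis
    define b where "b = (\<lambda>k. \<alpha> k (N k))"
    define J where "J = (\<lambda>k. limfun (\<lambda>n. b k))"
    have bL: "b k \<in> lists (K \<times> UNIV)" for k using \<alpha>(1)[of k] by (simp add: b_def Kcauchy_def)
    note Jc = Kcauchy_const[OF bL]
    have carr: "J k \<in> carrier rkhs" "\<sigma> k \<in> carrier rkhs" for k using Jc \<alpha> by (auto simp: J_def)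
    have near: "vdist rkhs (\<sigma> k) (J k) \<le> 1 / Suc k" for k
      unfolding \<alpha>(2) J_def
    proof (rule LIMSEQ_le_const2[OF rkhs_vdist_tendsto[OF \<alpha>(1) Jc]])
      show "\<exists>M. \<forall>n\<ge>M. nrm (formal_diff (\<alpha> k n) (b k)) \<le> 1 / Suc k"
        using N[of k] unfolding b_def by (intro exI[of _ "N k"]) (auto intro: less_imp_le)
    qed
    have JJ: "vdist rkhs (J k) (J l) = nrm (formal_diff (b k) (b l))" for k l
      using rkhs_vdist_tendsto[OF Jc[of k] Jc[of l]] by (simp add: J_def LIMSEQ_const_iff)
    have small: "\<exists>M. \<forall>k\<ge>M. 1 / Suc k < e" if "e > 0" for e :: real
      using LIMSEQ_D[OF LIMSEQ_inverse_real_of_nat that]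
      by (simp add: inverse_eq_divide)
    have b: "Kcauchy b"
      unfolding Kcauchy_def
    proof (intro conjI allI impI bL)
      fix e :: real assume e: "e > 0"
      obtain M where M: "\<forall>k\<ge>M. 1 / Suc k < e / 3" using small[of "e / 3"] e by auto
      obtain M' where M': "\<forall>k l. M' \<le> k \<longrightarrow> M' \<le> l \<longrightarrow> vdist rkhs (\<sigma> k) (\<sigma> l) < e / 3"
        using c e unfolding m.MCauchy_def by (meson zero_less_divide_iff zero_less_numeral)
      have "nrm (formal_diff (b k) (b l)) < e" if "k \<ge> max M M'" "l \<ge> max M M'" for k l
      proof -
        have "vdist rkhs (J k) (J l) \<le> vdist rkhs (J k) (\<sigma> k) + vdist rkhs (\<sigma> k) (J l)"
          by (intro m.triangle carr)
        also have "vdist rkhs (\<sigma> k) (J l) \<le> vdist rkhs (\<sigma> k) (\<sigma> l) + vdist rkhs (\<sigma> l) (J l)"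
          by (intro m.triangle carr)
        finally have "vdist rkhs (J k) (J l) \<le> 1 / Suc k + (vdist rkhs (\<sigma> k) (\<sigma> l) + 1 / Suc l)"
          using near[of k] near[of l] m.commute[of "J k" "\<sigma> k"] by linarith
        moreover have "1 / Suc k < e / 3" "1 / Suc l < e / 3" "vdist rkhs (\<sigma> k) (\<sigma> l) < e / 3"
          using M M' that by auto
        ultimately show ?thesis unfolding JJ by linarith
      qed
      then show "\<exists>M. \<forall>k\<ge>M. \<forall>l\<ge>M. nrm (formal_diff (b k) (b l)) < e" by blast
    qed
    have "limitin m.mtopology \<sigma> (limfun b) sequentially"
      unfolding m.limit_metric_sequentially
    proof (intro conjI allI impI)
      show bc: "limfun b \<in> carrier rkhs" using b by simp
      fix e :: real assume e: "e > 0"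
      obtain M where M: "\<forall>k\<ge>M. 1 / Suc k < e / 2" using small[of "e / 2"] e by auto
      obtain M' where M': "\<forall>k\<ge>M'. \<forall>l\<ge>M'. nrm (formal_diff (b k) (b l)) < e / 2"
        using KcauchyD[OF b, of "e / 2"] e by auto
      have "vdist rkhs (\<sigma> k) (limfun b) < e" if k: "k \<ge> max M M'" for k
      proof -
        have "vdist rkhs (J k) (limfun b) \<le> e / 2"
          unfolding J_def
        proof (rule LIMSEQ_le_const2[OF rkhs_vdist_tendsto[OF Jc b]])
          show "\<exists>M. \<forall>n\<ge>M. nrm (formal_diff (b k) (b n)) \<le> e / 2"
            using M' k by (intro exI[of _ M']) (auto intro: less_imp_le)
        qed
        moreover have "1 / Suc k < e / 2" using M k by simp
        ultimately show ?thesis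
          using m.triangle[OF carr(2) carr(1) bc, of k k] near[of k] by linarith
      qed
      then show "\<exists>M. \<forall>k\<ge>M. \<sigma> k \<in> carrier rkhs \<and> vdist rkhs (\<sigma> k) (limfun b) < e"
        using carr(2) by blast
    qed
    then show "\<exists>f. limitin m.mtopology \<sigma> f sequentially" by blast
  qed
qed

lemma rkhs_hilbert_space: "hilbert_space K rkhs"
proof (intro hilbert_space.intro banach_space.intro rkhs_normed_space banach_space_axioms.intro
    rkhs_complete hilbert_space_axioms.intro)
  \<comment> \<open>Coefficients and kernel values in \<open>K\<close> keep the form in
    \<open>K\<close>; closedness of \<open>K\<close> extends this to the limits.\<close>
  have formK: "form a b \<in> K" if "a \<in> lists (K \<times> UNIV)" "b \<in> lists (K \<times> UNIV)" for a b
  proof -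
    have "ev a t \<in> K" for t
      using that(1) by (induction a) (auto intro!: K_add K_mult K_zero kernel_in)
    then show ?thesis
      using that(2) by (induction b) (auto intro!: K_add K_mult K_zero K_cnj)
  qed
  fix f g assume "f \<in> carrier rkhs" "g \<in> carrier rkhs"
  then obtain \<alpha> \<beta> where \<alpha>: "Kcauchy \<alpha>" "f = limfun \<alpha>" "Kcauchy \<beta>" "g = limfun \<beta>" by auto
  show "ip rkhs f g \<in> K"
    unfolding \<alpha> rkhs_ip[OF \<alpha>(1,3)]
    by (rule closed_sequentially[OF K_closed _ form_tendsto[OF \<alpha>(1,3)]])
      (use \<alpha> in \<open>auto simp: Kcauchy_def intro!: formK\<close>)
  show "ip rkhs g f = cnj (ip rkhs f g)"
    using lform_cnj[OF \<alpha>(1,3)] by (simp add: \<alpha> rkhs_ip)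
  fix c assume c: "c \<in> K"
  have "(\<lambda>n. c * form (\<alpha> n) (\<beta> n)) \<longlonglongrightarrow> lform (\<lambda>n. formal_scale c (\<alpha> n)) \<beta>"
    using form_tendsto[OF Kcauchy_scale[OF \<alpha>(1) c] \<alpha>(3)] by simp
  then have "lform (\<lambda>n. formal_scale c (\<alpha> n)) \<beta> = c * lform \<alpha> \<beta>"
    using LIMSEQ_unique tendsto_mult_left[OF form_tendsto[OF \<alpha>(1,3)]] by blast
  then show "ip rkhs (c \<odot>\<^bsub>rkhs\<^esub> f) g = c * ip rkhs f g"
    unfolding \<alpha> using \<alpha> c
    by (simp add: rkhs_ip limfun_scale[symmetric] Kcauchy_scale)
next
  fix f assume "f \<in> carrier rkhs"
  then obtain \<alpha> where \<alpha>: "Kcauchy \<alpha>" "f = limfun \<alpha>" by auto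
  have "(\<lambda>n. form (\<alpha> n) (\<alpha> n)) \<longlonglongrightarrow> complex_of_real ((vnorm rkhs f)\<^sup>2)"
    unfolding form_self \<alpha> by (intro tendsto_of_real tendsto_power rkhs_vnorm_tendsto \<alpha>)
  then show "ip rkhs f f = complex_of_real ((vnorm rkhs f)\<^sup>2)"
    using LIMSEQ_unique form_tendsto[OF \<alpha>(1,1)] \<alpha> by (simp add: rkhs_ip)
next
  fix f g h assume "f \<in> carrier rkhs" "g \<in> carrier rkhs" "h \<in> carrier rkhs"
  then obtain \<alpha> \<beta> \<gamma> where \<alpha>: "Kcauchy \<alpha>" "f = limfun \<alpha>" "Kcauchy \<beta>" "g = limfun \<beta>"
    "Kcauchy \<gamma>" "h = limfun \<gamma>" by auto
  have "(\<lambda>n. form (\<alpha> n) (\<gamma> n) + form (\<beta> n) (\<gamma> n)) \<longlonglongrightarrow> lform (\<lambda>n. \<alpha> n @ \<beta> n) \<gamma>"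
    using form_tendsto[OF Kcauchy_append[OF \<alpha>(1,3)] \<alpha>(5)] by simp
  then have "lform (\<lambda>n. \<alpha> n @ \<beta> n) \<gamma> = lform \<alpha> \<gamma> + lform \<beta> \<gamma>"
    using LIMSEQ_unique tendsto_add[OF form_tendsto[OF \<alpha>(1,5)] form_tendsto[OF \<alpha>(3,5)]] by blast
  then show "ip rkhs (f \<oplus>\<^bsub>rkhs\<^esub> g) h = ip rkhs f h + ip rkhs g h"
    unfolding \<alpha> using \<alpha> by (simp add: rkhs_ip limfun_append[symmetric] Kcauchy_append)
qed

lemma kernel_in_rkhs: "q s \<in> carrier rkhs"
  using Kcauchy_const[of "[(1, s)]"] K_one limfun_const[of s, symmetric] by simp

lemma rkhs_ip_kernel: "ip rkhs (q s) (q t) = q s t"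
proof -
  have c: "Kcauchy (\<lambda>n. [(1, s)])" for s by (rule Kcauchy_const) (simp add: K_one)
  have "(\<lambda>n. q s t) \<longlonglongrightarrow> ip rkhs (q s) (q t)"
    using form_tendsto[OF c[of s] c[of t]] rkhs_ip[OF c[of s] c[of t]] by (simp add: limfun_const)
  then show ?thesis by (simp add: LIMSEQ_const_iff)
qed

end

section \<open>Domination by a kernel\<close>

lemma K_of_real:
  assumes "K = \<real> \<or> K = UNIV"
  shows "complex_of_real r \<in> K"
  using assms by auto

lemma scalars_simps:
  "carrier (scalars K) = K" "add (scalars K) = (+)" "smult (scalars K) = (*)"
  "vnorm (scalars K) = cmod"
  by (simp_all add: scalars_def)

text \<open>The value 0 off the tuples makes every kernel bounded by \<open>norm_prod\<close> vanish
  there, so that all bounds can be stated for total functions.\<close>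

definition norm_prod :: "nat \<Rightarrow> (nat \<Rightarrow> ('a, 'm) nspace_scheme) \<Rightarrow> (nat \<Rightarrow> 'a) \<Rightarrow> real" where
  "norm_prod n X u = (if u \<in> tuples n X then \<Prod>i<n. vnorm (X i) (u i) else 0)"

lemma norm_prod_nonneg:
  assumes "\<And>i. i < n \<Longrightarrow> normed_space K (X i)"
  shows "0 \<le> norm_prod n X u"
  unfolding norm_prod_def
  by (auto intro!: prod_nonneg normed_space.vnorm_nonneg[OF assms] simp: tuples_def PiE_iff)

lemma norm_prod_le_1:
  assumes X: "\<And>i. i < n \<Longrightarrow> normed_space K (X i)" and u: "u \<in> unit_tuples n X"
  shows "norm_prod n X u \<le> 1"
  using u unfolding norm_prod_def
  by (auto intro!: prod_le_1 normed_space.vnorm_nonneg[OF X] simp: unit_tuples_def tuples_def PiE_iff)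

lemma tuplesD: "u \<in> tuples n X \<Longrightarrow> i < n \<Longrightarrow> u i \<in> carrier (X i)"
  by (auto simp: tuples_def)

lemma multilinear_smult:
  assumes "multilinear K n X Y T" "u \<in> tuples n X" "i < n" "c \<in> K"
  shows "T (u(i := c \<odot>\<^bsub>X i\<^esub> u i)) = c \<odot>\<^bsub>Y\<^esub> T u"
  using assms tuplesD[OF assms(2,3)] unfolding multilinear_def by (metis fun_upd_triv)

lemma multilinear_prod_smult:
  assumes X: "\<And>i. i < n \<Longrightarrow> normed_space K (X i)"
    and \<phi>: "multilinear K n X (scalars K) \<phi>" and u: "u \<in> tuples n X"
    and c: "\<And>i. i < n \<Longrightarrow> c i \<in> K" and k: "k \<le> n"
  shows "(\<lambda>i. if i < k then c i \<odot>\<^bsub>X i\<^esub> u i else u i) \<in> tuples n X \<and>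
    \<phi> (\<lambda>i. if i < k then c i \<odot>\<^bsub>X i\<^esub> u i else u i) = (\<Prod>i<k. c i) * \<phi> u"
  using k
proof (induction k)
  case 0
  then show ?case using u by simp
next
  case (Suc k)
  define v where "v = (\<lambda>i. if i < k then c i \<odot>\<^bsub>X i\<^esub> u i else u i)"
  have v: "v \<in> tuples n X" "\<phi> v = (\<Prod>i<k. c i) * \<phi> u" and k: "k < n"
    using Suc by (auto simp: v_def)
  have eq: "(\<lambda>i. if i < Suc k then c i \<odot>\<^bsub>X i\<^esub> u i else u i) = v(k := c k \<odot>\<^bsub>X k\<^esub> v k)"
    by (auto simp: v_def fun_eq_iff less_Suc_eq)
  interpret normed_space K "X k" by (rule X[OF k])
  have "c k \<odot>\<^bsub>X k\<^esub> v k \<in> carrier (X k)"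
    using c[OF k] tuplesD[OF v(1) k] by (simp add: scalars_simps)
  then show ?case
    unfolding eq using multilinear_smult[OF \<phi> v(1) k c[OF k]] v k
    by (simp add: tuples_upd scalars_simps)
qed

text \<open>If all coordinates have positive norm, dividing each by its norm gives a unit tuple, and
  homogeneity restores the factors. Otherwise some coordinate is zero and the form vanishes.\<close>

lemma multilinear_form_bound:
  assumes K: "K = \<real> \<or> K = UNIV" and X: "\<And>i. i < n \<Longrightarrow> normed_space K (X i)"
    and \<phi>: "bounded_multilinear K n X (scalars K) \<phi>" "mnorm n X (scalars K) \<phi> \<le> 1"
    and u: "u \<in> tuples n X"
  shows "cmod (\<phi> u) \<le> norm_prod n X u"
proof (cases "\<forall>i<n. 0 < vnorm (X i) (u i)")
  case True
  define c where "c = (\<lambda>i. complex_of_real (1 / vnorm (X i) (u i)))"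
  define v where "v = (\<lambda>i. if i < n then c i \<odot>\<^bsub>X i\<^esub> u i else u i)"
  have m: "multilinear K n X (scalars K) \<phi>" using \<phi> by (simp add: bounded_multilinear_def)
  have c: "c i \<in> K" for i unfolding c_def by (rule K_of_real[OF K])
  have v: "v \<in> tuples n X" "\<phi> v = (\<Prod>i<n. c i) * \<phi> u"
    using multilinear_prod_smult[OF X m u c order_refl] by (auto simp: v_def)
  have "vnorm (X i) (v i) = 1" if i: "i < n" for i
    using normed_space.vnorm_smult[OF X[OF i] c tuplesD[OF u i], of i]
      True[rule_format, OF i] i
    by (simp add: v_def c_def norm_divide)
  then have "v \<in> unit_tuples n X" using v by (simp add: unit_tuples_def)
  then have "cmod (\<phi> v) \<le> mnorm n X (scalars K) \<phi>"
    using \<phi>(1) unfolding mnorm_def bounded_multilinear_def scalars_simps by (intro cSUP_upper) auto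
  then have "cmod (\<phi> v) \<le> 1" using \<phi>(2) by linarith
  moreover have "cmod (\<phi> v) = cmod (\<phi> u) / (\<Prod>i<n. vnorm (X i) (u i))"
  proof -
    have "cmod (\<Prod>i<n. c i) = (\<Prod>i<n. 1 / vnorm (X i) (u i))"
      unfolding prod_norm[symmetric] using True by (intro prod.cong) (auto simp: c_def norm_divide)
    then show ?thesis by (simp add: v(2) norm_mult prod_dividef)
  qed
  moreover have "0 < (\<Prod>i<n. vnorm (X i) (u i))" using True by (intro prod_pos) auto
  ultimately show ?thesis using u by (simp add: norm_prod_def)
next
  case False
  then obtain i where i: "i < n" "\<not> 0 < vnorm (X i) (u i)" by auto
  interpret normed_space K "X i" by (rule X[OF i(1)])
  have ui: "u i \<in> carrier (X i)" by (rule tuplesD[OF u i(1)])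
  have "vnorm (X i) (u i) = 0" using vnorm_nonneg[OF ui] i(2) by simp
  then have "vnorm (X i) (0 \<odot>\<^bsub>X i\<^esub> u i) = 0 \<and> 0 \<odot>\<^bsub>X i\<^esub> u i \<in> carrier (X i)"
    using ui K_of_real[OF K, of 0] vnorm_smult[of 0 "u i"] smult_closed[of 0 "u i"]
    by (simp add: scalars_simps)
  \<comment> \<open>Both \<open>u i\<close> and its multiple by the scalar 0 have norm 0, hence both
    are the zero vector; homogeneity with this scalar gives \<open>\<phi> u = 0\<close>.\<close>
  then have "u(i := 0 \<odot>\<^bsub>X i\<^esub> u i) = u"
    using \<open>vnorm (X i) (u i) = 0\<close> ui vnorm_eq_0_iff by (metis fun_upd_triv)
  then have "\<phi> u = 0"
    using multilinear_smult[of K n X "scalars K" \<phi> u i 0] \<phi>(1) u i(1) K_of_real[OF K, of 0]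
    by (simp add: bounded_multilinear_def scalars_simps)
  then show ?thesis using norm_prod_nonneg[OF X] by simp
qed

section \<open>The compact convex set of kernels\<close>

text \<open>The two factors of the intersection serve the compactness proof: the first is a product
  of discs, the second is closed for pointwise convergence.\<close>

definition kernels ::
  "complex set \<Rightarrow> nat \<Rightarrow> (nat \<Rightarrow> ('a, 'm) nspace_scheme) \<Rightarrow> ((nat \<Rightarrow> 'a) \<Rightarrow> (nat \<Rightarrow> 'a) \<Rightarrow> complex) set"
  where
  "kernels K n X = {q. \<forall>s t. cmod (q s t) \<le> norm_prod n X s * norm_prod n X t} \<inter>
     {q. (\<forall>s t. q s t \<in> K \<and> q t s = cnj (q s t)) \<and> (\<forall>a. 0 \<le> Re (kernel_form q a a)) \<and>
       (\<forall>t. multilinear K n X (scalars K) (\<lambda>s. q s t))}"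

lemma kernelsD:
  assumes "q \<in> kernels K n X"
  shows "cmod (q s t) \<le> norm_prod n X s * norm_prod n X t" "q s t \<in> K" "q t s = cnj (q s t)"
    "0 \<le> Re (kernel_form q a a)" "multilinear K n X (scalars K) (\<lambda>s. q s t)"
  using assms unfolding kernels_def by blast+

lemma continuous_kernel: "continuous_on UNIV (\<lambda>q. q s t :: 'b::topological_space)"
  by (rule continuous_on_product_then_coordinatewise[OF continuous_on_product_coordinates])

lemma continuous_kernel_form: "continuous_on UNIV (\<lambda>q. kernel_form q a b)"
proof -
  have "continuous_on UNIV (\<lambda>q. kernel_sum q a t)" for t
    by (induction a) (auto simp: continuous_on_add continuous_on_mult continuous_kernel continuous_on_const)
  then show ?thesis
    by (induction b) (auto simp: continuous_on_add continuous_on_mult continuous_on_const)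
qed

text \<open>Kernels are curried, so Tychonoff's theorem is applied twice, once for each variable.
  The other conditions are closed because each instance of them involves only finitely many values
  of \<open>q\<close>.\<close>

lemma compact_kernels:
  assumes K: "closed K"
  shows "compact (kernels K n X)"
proof -
  let ?N = "norm_prod n X"
  have box: "{q. \<forall>s t. cmod (q s t) \<le> ?N s * ?N t} =
      PiE UNIV (\<lambda>s. PiE UNIV (\<lambda>t. cball 0 (?N s * ?N t)))"
    by (auto simp: PiE_iff)
  have "compact (PiE UNIV (\<lambda>t. cball 0 (?N s * ?N t) :: complex set))" for s
    using compactin_PiE[of "\<lambda>_. euclidean" UNIV "\<lambda>t. cball 0 (?N s * ?N t) :: complex set"]
    by (simp add: euclidean_product_topology)
  then have "compact {q. \<forall>s t. cmod (q s t) \<le> ?N s * ?N t}"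
    unfolding box
    using compactin_PiE[of "\<lambda>_. euclidean" UNIV "\<lambda>s. PiE UNIV (\<lambda>t. cball 0 (?N s * ?N t) :: complex set)"]
    by (simp add: euclidean_product_topology)
  moreover have "closed {q. (\<forall>s t. q s t \<in> K \<and> q t s = cnj (q s t)) \<and>
      (\<forall>a. 0 \<le> Re (kernel_form q a a)) \<and> (\<forall>t. multilinear K n X (scalars K) (\<lambda>s. q s t))}"
    unfolding multilinear_def Ball_def Pi_iff scalars_simps
    by (intro closed_Collect_conj closed_Collect_all closed_Collect_imp open_Collect_const
        closed_Collect_eq closed_Collect_le continuous_intros continuous_kernel continuous_kernel_form
        closed_vimage[OF K, unfolded vimage_def])
  ultimately show ?thesis
    unfolding kernels_def by (rule compact_Int_closed)
qed

lemma kernel_form_mix: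
  "kernel_form (\<lambda>s t. x * q s t + y * q' s t) a b = x * kernel_form q a b + y * kernel_form q' a b"
proof -
  have *: "kernel_sum (\<lambda>s t. x * q s t + y * q' s t) a t = x * kernel_sum q a t + y * kernel_sum q' a t" for t
    by (induction a) (auto simp: algebra_simps)
  show ?thesis by (induction b) (auto simp: * algebra_simps)
qed

lemma convex_kernels:
  assumes K: "K = \<real> \<or> K = UNIV" and q: "q \<in> kernels K n X" "q' \<in> kernels K n X"
    and t: "0 \<le> t" "t \<le> 1"
  shows "(\<lambda>r s. of_real (1 - t) * q r s + of_real t * q' r s) \<in> kernels K n X"
proof -
  let ?p = "\<lambda>r s. of_real (1 - t) * q r s + of_real t * q' r s"
  have 1: "cmod (?p r s) \<le> norm_prod n X r * norm_prod n X s" for r s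
  proof -
    have "cmod (?p r s) \<le> (1 - t) * cmod (q r s) + t * cmod (q' r s)"
      using t by (intro norm_triangle_le) (simp add: norm_mult del: of_real_diff)
    also have "\<dots> \<le> (1 - t) * (norm_prod n X r * norm_prod n X s) + t * (norm_prod n X r * norm_prod n X s)"
      using t by (intro add_mono mult_left_mono kernelsD(1)[OF q(1)] kernelsD(1)[OF q(2)]) auto
    finally show ?thesis by (simp add: algebra_simps)
  qed
  have 2: "?p r s \<in> K" for r s
    using K kernelsD(2)[OF q(1)] kernelsD(2)[OF q(2)] by auto
  have 3: "?p s r = cnj (?p r s)" for r s
    using kernelsD(3)[OF q(1), of s r] kernelsD(3)[OF q(2), of s r] by simp
  have 4: "0 \<le> Re (kernel_form ?p a a)" for a
    unfolding kernel_form_mix using kernelsD(4)[OF q(1)] kernelsD(4)[OF q(2)] t by (simp del: of_real_diff)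
  have 5: "multilinear K n X (scalars K) (\<lambda>r. ?p r s)" for s
  proof -
    show ?thesis
      using 2 kernelsD(5)[OF q(1), of s] kernelsD(5)[OF q(2), of s]
      unfolding multilinear_def scalars_simps
      by (simp add: distrib_left mult.left_commute Pi_iff)
  qed
  show ?thesis unfolding kernels_def using 1 2 3 4 5 by blast
qed

text \<open>Positivity holds because the form of this kernel factors as
  \<open>z a * cnj (z b)\<close>, with \<open>z\<close> the linear extension of
  \<open>\<psi>\<close> to lists. The form is cut off outside the tuples because its values there
  are arbitrary, while the kernel bound requires 0.\<close>

lemma rank_one_in_kernels:
  assumes K: "K = \<real> \<or> K = UNIV" and X: "\<And>i. i < n \<Longrightarrow> normed_space K (X i)"
    and \<phi>: "bounded_multilinear K n X (scalars K) \<phi>" "mnorm n X (scalars K) \<phi> \<le> 1"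
  defines "\<psi> \<equiv> \<lambda>s. if s \<in> tuples n X then \<phi> s else 0"
  shows "(\<lambda>s t. \<psi> s * cnj (\<psi> t)) \<in> kernels K n X"
proof -
  let ?p = "\<lambda>s t. \<psi> s * cnj (\<psi> t)"
  have m: "multilinear K n X (scalars K) \<phi>" using \<phi> by (simp add: bounded_multilinear_def)
  have b: "cmod (\<psi> s) \<le> norm_prod n X s" for s
    using multilinear_form_bound[OF K X \<phi>] norm_prod_nonneg[OF X] by (simp add: \<psi>_def)
  have 1: "cmod (?p s t) \<le> norm_prod n X s * norm_prod n X t" for s t
    using b by (auto simp: norm_mult intro!: mult_mono norm_prod_nonneg[OF X])
  have \<psi>K: "\<psi> s \<in> K" for s
    using m K by (auto simp: \<psi>_def multilinear_def scalars_simps)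
  have 2: "?p s t \<in> K" for s t
    using K \<psi>K[of s] \<psi>K[of t] by (auto simp: Reals_cnj_iff)
  have 4: "0 \<le> Re (kernel_form ?p a a)" for a
  proof -
    define z where "z = (\<lambda>a. \<Sum>(c, s)\<leftarrow>a. c * \<psi> s)"
    have s: "kernel_sum ?p a t = z a * cnj (\<psi> t)" for a t
      by (induction a) (auto simp: z_def algebra_simps)
    have "kernel_form ?p a b = z a * cnj (z b)" for a b
      by (induction b) (auto simp: s, auto simp: z_def algebra_simps)
    then show ?thesis by (simp add: complex_norm_square[symmetric])
  qed
  have 5: "multilinear K n X (scalars K) (\<lambda>s. ?p s t)" for t
    unfolding multilinear_def
  proof (intro conjI ballI allI impI)
    show "(\<lambda>s. ?p s t) \<in> tuples n X \<rightarrow> carrier (scalars K)" using 2 by (simp add: scalars_simps)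
  next
    fix u i x y assume u: "u \<in> tuples n X" "i < n" "x \<in> carrier (X i)" "y \<in> carrier (X i)"
    interpret normed_space K "X i" by (rule X[OF u(2)])
    show "?p (u(i := x \<oplus>\<^bsub>X i\<^esub> y)) t = ?p (u(i := x)) t \<oplus>\<^bsub>scalars K\<^esub> ?p (u(i := y)) t"
      using m u by (simp add: \<psi>_def tuples_upd multilinear_def scalars_simps algebra_simps)
  next
    fix u i c x assume u: "u \<in> tuples n X" "i < n" "c \<in> K" "x \<in> carrier (X i)"
    interpret normed_space K "X i" by (rule X[OF u(2)])
    have "c \<odot>\<^bsub>X i\<^esub> x \<in> carrier (X i)" using u by (simp add: scalars_simps)
    then show "?p (u(i := c \<odot>\<^bsub>X i\<^esub> x)) t = c \<odot>\<^bsub>scalars K\<^esub> ?p (u(i := x)) t"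
      using m u by (simp add: \<psi>_def tuples_upd multilinear_def scalars_simps)
  qed
  show ?thesis unfolding kernels_def using 1 2 4 5 by (auto simp: mult.commute)
qed

lemma unit_tuples_nonempty:
  assumes X: "\<And>i. i < n \<Longrightarrow> normed_space K (X i)"
  shows "unit_tuples n X \<noteq> {}"
proof -
  have "\<zero>\<^bsub>X i\<^esub> \<in> carrier (X i) \<and> vnorm (X i) \<zero>\<^bsub>X i\<^esub> = 0" if "i < n" for i
  proof -
    interpret normed_space K "X i" by (rule X[OF that])
    show ?thesis by (simp add: vnorm_zero)
  qed
  then have "(\<lambda>i\<in>{..<n}. \<zero>\<^bsub>X i\<^esub>) \<in> unit_tuples n X"
    by (auto simp: unit_tuples_def tuples_def)
  then show ?thesis by blast
qed

text \<open>Supplies the zero kernel and shows that the supremum in \<open>weak_lip2\<close> is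
  taken over a nonempty set.\<close>

lemma zero_form:
  assumes K: "K = \<real> \<or> K = UNIV" and X: "\<And>i. i < n \<Longrightarrow> normed_space K (X i)"
  shows "bounded_multilinear K n X (scalars K) (\<lambda>u. 0)" "mnorm n X (scalars K) (\<lambda>u. 0) \<le> 1"
  using K_of_real[OF K, of 0] unit_tuples_nonempty[OF X]
  by (auto simp: bounded_multilinear_def multilinear_def scalars_simps bdd_above_def mnorm_def)

section \<open>Existence of a dominating kernel\<close>

text \<open>No Hilbert space appears here, so that the expression is visibly continuous in
  \<open>q\<close> and affine along mixtures, as \<open>minimax\<close> requires.\<close>

definition kernel_sqdist :: "('p \<Rightarrow> 'p \<Rightarrow> complex) \<Rightarrow> 'p \<Rightarrow> 'p \<Rightarrow> real" where
  "kernel_sqdist q u v = Re (q u u - q u v - q v u + q v v)"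

lemma kernel_sqdist_rank_one:
  "kernel_sqdist (\<lambda>s t. \<psi> s * cnj (\<psi> t)) u v = (cmod (\<psi> u - \<psi> v))\<^sup>2"
proof -
  have "\<psi> u * cnj (\<psi> u) - \<psi> u * cnj (\<psi> v) - \<psi> v * cnj (\<psi> u) + \<psi> v * cnj (\<psi> v) =
      (\<psi> u - \<psi> v) * cnj (\<psi> u - \<psi> v)"
    by (simp add: algebra_simps)
  then show ?thesis
    unfolding kernel_sqdist_def by (simp add: complex_norm_square[symmetric] del: complex_cnj_diff)
qed

text \<open>
  Multilinearity absorbs weights: repeated pairs are not needed, since rescaling the coordinate 0 of
  both tuples multiplies the squared distance by \<open>w\<close>.
\<close>

lemma multilinear_rescaled_diff:
  assumes K: "K = \<real> \<or> K = UNIV" and n: "1 \<le> n" and Y: "normed_space K Y"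
    and T: "multilinear K n X Y T" and u: "u \<in> tuples n X" and v: "v \<in> tuples n X" and w: "0 \<le> w"
  shows "(vnorm Y (T (u(0 := of_real (sqrt w) \<odot>\<^bsub>X 0\<^esub> u 0)) \<ominus>\<^bsub>Y\<^esub> T (v(0 := of_real (sqrt w) \<odot>\<^bsub>X 0\<^esub> v 0))))\<^sup>2
    = w * (vnorm Y (T u \<ominus>\<^bsub>Y\<^esub> T v))\<^sup>2"
proof -
  interpret Y: normed_space K Y by (rule Y)
  let ?c = "complex_of_real (sqrt w)"
  have c: "?c \<in> K" by (rule K_of_real[OF K])
  have TY: "T u \<in> carrier Y" "T v \<in> carrier Y" using T u v by (auto simp: multilinear_def)
  have "T (u(0 := ?c \<odot>\<^bsub>X 0\<^esub> u 0)) \<ominus>\<^bsub>Y\<^esub> T (v(0 := ?c \<odot>\<^bsub>X 0\<^esub> v 0)) = ?c \<odot>\<^bsub>Y\<^esub> T u \<ominus>\<^bsub>Y\<^esub> ?c \<odot>\<^bsub>Y\<^esub> T v"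
    using n by (simp add: multilinear_smult[OF T _ _ c] u v)
  also have "\<dots> = ?c \<odot>\<^bsub>Y\<^esub> (T u \<ominus>\<^bsub>Y\<^esub> T v)"
    using c TY by (simp add: a_minus_def Y.smult_r_distr Y.smult_r_minus scalars_simps)
  finally show ?thesis
    using c TY w by (simp add: Y.vnorm_smult power_mult_distrib)
qed


lemma kernel_sqdist_mix:
  "kernel_sqdist (\<lambda>r s. of_real (1 - t) * q r s + of_real t * q' r s) u v =
    (1 - t) * kernel_sqdist q u v + t * kernel_sqdist q' u v"
  by (simp add: kernel_sqdist_def algebra_simps)

text \<open>In \<open>minimax\<close> the indices are all pairs of tuples. Its hypothesis on weights
  is the summing inequality for the rescaled pairs: each form \<open>\<phi>\<close> in the supremum
  gives a rank-one kernel, at which the weighted sum is at most \<open>c\<close>.\<close>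

lemma lip2_dominating_kernel:
  fixes X :: "nat \<Rightarrow> ('a, 'm) nspace_scheme"
  assumes K: "K = \<real> \<or> K = UNIV" and n: "1 \<le> n"
    and X: "\<And>i. i < n \<Longrightarrow> normed_space K (X i)" and Y: "normed_space K Y"
    and T: "multilinear K n X Y T" and C: "lip2_bound K n X Y T C"
  obtains q where "q \<in> kernels K n X"
    "\<And>u v. u \<in> tuples n X \<Longrightarrow> v \<in> tuples n X \<Longrightarrow>
      (vnorm Y (T u \<ominus>\<^bsub>Y\<^esub> T v))\<^sup>2 \<le> C\<^sup>2 * kernel_sqdist q u v"
proof -
  let ?P = "tuples n X"
  let ?\<Phi> = "{\<phi>. bounded_multilinear K n X (scalars K) \<phi> \<and> mnorm n X (scalars K) \<phi> \<le> 1}"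
  define d :: "(nat \<Rightarrow> 'a) \<times> (nat \<Rightarrow> 'a) \<Rightarrow> ((nat \<Rightarrow> 'a) \<Rightarrow> (nat \<Rightarrow> 'a) \<Rightarrow> complex) \<Rightarrow> real"
    where "d = (\<lambda>(u, v) q. C\<^sup>2 * kernel_sqdist q u v)"
  define b where "b = (\<lambda>(u, v). (vnorm Y (T u \<ominus>\<^bsub>Y\<^esub> T v))\<^sup>2)"
  have C0: "0 \<le> C" using C by (simp add: lip2_bound_def)
  have clK: "closed K" using K by (auto simp: closed_complex_Reals)
  have zero: "(\<lambda>s t. 0) \<in> kernels K n X"
    using rank_one_in_kernels[OF K X zero_form[OF K X]]
    by simp
  have "\<exists>q\<in>kernels K n X. \<forall>i\<in>?P \<times> ?P. b i \<le> d i q"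
  proof (rule minimax)
    show "compact (kernels K n X)" by (rule compact_kernels[OF clK])
    show "kernels K n X \<noteq> {}" using zero by blast
    show "continuous_on UNIV (d i)" for i
      by (cases i) (auto simp: d_def kernel_sqdist_def intro!: continuous_intros continuous_kernel)
  next
    fix q q' :: "(nat \<Rightarrow> 'a) \<Rightarrow> (nat \<Rightarrow> 'a) \<Rightarrow> complex" and t :: real
    assume q: "q \<in> kernels K n X" "q' \<in> kernels K n X" and t: "0 \<le> t" "t \<le> 1"
    show "\<exists>q''\<in>kernels K n X. \<forall>i\<in>?P \<times> ?P. d i q'' = (1 - t) * d i q + t * d i q'"
      by (rule bexI[OF _ convex_kernels[OF K q t]])
        (simp add: d_def split_beta kernel_sqdist_mix distrib_left mult.left_commute del: of_real_diff)
  next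
    fix J w c assume J: "finite J" "J \<subseteq> ?P \<times> ?P" and w: "\<And>i. i \<in> J \<Longrightarrow> 0 \<le> w i"
      and le: "\<And>q. q \<in> kernels K n X \<Longrightarrow> (\<Sum>i\<in>J. w i * d i q) \<le> c"
    \<comment> \<open>The case \<open>C = 0\<close> below needs this, since there the supremum
      cannot be bounded by dividing by \<open>C\<close>.\<close>
    have c0: "0 \<le> c"
      using le[OF zero] by (simp add: d_def kernel_sqdist_def split_beta)
    obtain f where f: "bij_betw f {..<card J} J"
      using ex_bij_betw_nat_finite[OF J(1)] by (auto simp: atLeast0LessThan)
    \<comment> \<open>The root is taken because the factor comes out of a squared norm.\<close>
    define r where "r = (\<lambda>i (u :: nat \<Rightarrow> 'a). u(0 := of_real (sqrt (w i)) \<odot>\<^bsub>X 0\<^esub> u 0))"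
    define u v where "u = (\<lambda>k. r (f k) (fst (f k)))" and "v = (\<lambda>k. r (f k) (snd (f k)))"
    have fJ: "f k \<in> J" "fst (f k) \<in> ?P" "snd (f k) \<in> ?P" if "k < card J" for k
  proof -
    show "f k \<in> J" using f that by (auto simp: bij_betw_def)
    then have "f k \<in> ?P \<times> ?P" using J(2) by blast
    then show "fst (f k) \<in> ?P" "snd (f k) \<in> ?P" by (simp_all add: mem_Times_iff)
  qed
    have rP: "r i s \<in> ?P" if "s \<in> ?P" for i s
    proof -
      interpret normed_space K "X 0" using X n by simp
      have "complex_of_real (sqrt (w i)) \<odot>\<^bsub>X 0\<^esub> s 0 \<in> carrier (X 0)"
        using tuplesD[OF that, of 0] n K_of_real[OF K] by (simp add: scalars_simps)
      then show ?thesis unfolding r_def using that n by (intro tuples_upd) auto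
    qed
    have "(\<Sum>i\<in>J. w i * b i) = (\<Sum>k<card J. w (f k) * b (f k))"
      by (rule sum.reindex_bij_betw[OF f, symmetric])
    also have "\<dots> = (\<Sum>k<card J. (vnorm Y (T (u k) \<ominus>\<^bsub>Y\<^esub> T (v k)))\<^sup>2)"
      using fJ multilinear_rescaled_diff[OF K n Y T] w
      by (intro sum.cong refl) (simp add: u_def v_def r_def b_def split_beta)
    finally have bs: "(\<Sum>i\<in>J. w i * b i) = (\<Sum>k<card J. (vnorm Y (T (u k) \<ominus>\<^bsub>Y\<^esub> T (v k)))\<^sup>2)" .
    have weak: "C * sqrt (\<Sum>k<card J. (cmod (\<phi> (u k) - \<phi> (v k)))\<^sup>2) \<le> sqrt c" if \<phi>: "\<phi> \<in> ?\<Phi>" for \<phi>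
    proof -
      define \<psi> where "\<psi> = (\<lambda>s. if s \<in> ?P then \<phi> s else 0)"
      have m: "multilinear K n X (scalars K) \<phi>" using \<phi> by (simp add: bounded_multilinear_def)
      have \<phi>r: "\<phi> (r i s) = of_real (sqrt (w i)) * \<phi> s" if "s \<in> ?P" for i s
        using multilinear_smult[OF m that _ K_of_real[OF K], of 0] n by (simp add: r_def scalars_simps)
      have q: "(\<lambda>s t. \<psi> s * cnj (\<psi> t)) \<in> kernels K n X"
        unfolding \<psi>_def using \<phi> by (intro rank_one_in_kernels[OF K X]) auto
      have sq: "(cmod (\<phi> (u k) - \<phi> (v k)))\<^sup>2 = w (f k) * (cmod (\<psi> (fst (f k)) - \<psi> (snd (f k))))\<^sup>2"
        if k: "k < card J" for k
      proof -
        have "\<phi> (u k) - \<phi> (v k) = of_real (sqrt (w (f k))) * (\<psi> (fst (f k)) - \<psi> (snd (f k)))"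
          using fJ[OF k] by (simp add: u_def v_def \<phi>r \<psi>_def algebra_simps)
        then show ?thesis using w[OF fJ(1)[OF k]] by (simp add: norm_mult power_mult_distrib)
      qed
      have "C\<^sup>2 * (\<Sum>k<card J. (cmod (\<phi> (u k) - \<phi> (v k)))\<^sup>2) =
          (\<Sum>k<card J. w (f k) * d (f k) (\<lambda>s t. \<psi> s * cnj (\<psi> t)))"
        unfolding sum_distrib_left
        by (intro sum.cong refl) (simp add: sq d_def split_beta kernel_sqdist_rank_one)
      also have "\<dots> = (\<Sum>i\<in>J. w i * d i (\<lambda>s t. \<psi> s * cnj (\<psi> t)))"
        by (rule sum.reindex_bij_betw[OF f])
      also have "\<dots> \<le> c" by (rule le[OF q])
      finally show ?thesis
        using C0 real_sqrt_le_mono by (fastforce simp: real_sqrt_mult)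
    qed
    have "sqrt (\<Sum>i\<in>J. w i * b i) \<le> C * weak_lip2 K n X (card J) u v"
      unfolding bs using C fJ rP by (auto simp: lip2_bound_def u_def v_def)
    also have "\<dots> \<le> sqrt c"
    proof (cases "C = 0")
      case False
      then have C1: "0 < C" using C0 by simp
      have "weak_lip2 K n X (card J) u v \<le> sqrt c / C"
        unfolding weak_lip2_def
      proof (rule cSUP_least)
        have "(\<lambda>u. 0) \<in> ?\<Phi>" using zero_form[OF K X] by simp
        then show "?\<Phi> \<noteq> {}" by (metis empty_iff)
        fix \<phi> assume "\<phi> \<in> ?\<Phi>"
        from weak[OF this] show "sqrt (\<Sum>k<card J. (cmod (\<phi> (u k) - \<phi> (v k)))\<^sup>2) \<le> sqrt c / C"
          by (simp only: pos_le_divide_eq[OF C1] mult.commute[of _ C])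
      qed
      then show ?thesis by (simp only: pos_le_divide_eq[OF C1] mult.commute[of _ C])
    qed (use c0 in simp)
    finally show "(\<Sum>i\<in>J. w i * b i) \<le> c" by simp
  qed
  then show thesis using that by (fastforce simp: b_def d_def)
qed

section \<open>Factorization through the reproducing kernel space\<close>

lemma hilbert_factorization_of_kernel:
  fixes X :: "nat \<Rightarrow> ('a, 'm) nspace_scheme"
  assumes K: "K = \<real> \<or> K = UNIV"
    and X: "\<And>i. i < n \<Longrightarrow> normed_space K (X i)" and Y: "normed_space K Y"
    and T: "multilinear K n X Y T" and C: "0 \<le> C" and q: "q \<in> kernels K n X"
    and dom: "\<And>u v. u \<in> tuples n X \<Longrightarrow> v \<in> tuples n X \<Longrightarrow>
      (vnorm Y (T u \<ominus>\<^bsub>Y\<^esub> T v))\<^sup>2 \<le> C\<^sup>2 * kernel_sqdist q u v"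
  obtains H :: "((nat \<Rightarrow> 'a) \<Rightarrow> complex) ipspace" and M B
  where "hilbert_factorization K n X Y T H M q B" "mnorm n X H q \<le> 1" "lip_bound H M Y B C"
proof -
  let ?P = "tuples n X"
  interpret psd_kernel K q
    by unfold_locales (rule K kernelsD(2-4)[OF q])+
  interpret H: hilbert_space K rkhs by (rule rkhs_hilbert_space)
  interpret Y: normed_space K Y by (rule Y)
  define B where "B = (\<lambda>f. T (SOME u. u \<in> ?P \<and> q u = f))"
  have TY: "T u \<in> carrier Y" if "u \<in> ?P" for u using T that by (auto simp: multilinear_def)
  have dist: "(vnorm rkhs (q u \<ominus>\<^bsub>rkhs\<^esub> q v))\<^sup>2 = kernel_sqdist q u v" for u v
  proof -
    note c = kernel_in_rkhs
    let ?z = "q u \<ominus>\<^bsub>rkhs\<^esub> q v"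
    have z: "?z \<in> carrier rkhs" by (intro H.M.minus_closed c)
    have i: "ip rkhs ?z (q s) = q u s - q v s" for s
      by (simp add: H.ip_diff[OF c c c] rkhs_ip_kernel)
    have "ip rkhs ?z ?z = ip rkhs (q u) ?z - ip rkhs (q v) ?z" by (rule H.ip_diff[OF c c z])
    also have "\<dots> = cnj (q u u - q v u) - cnj (q u v - q v v)"
      by (simp only: H.ip_cnj[OF z c] i)
    finally have "complex_of_real ((vnorm rkhs ?z)\<^sup>2) = cnj (q u u - q v u) - cnj (q u v - q v v)"
      by (simp only: H.ip_norm[OF z])
    from arg_cong[OF this, of Re] show ?thesis by (simp add: kernel_sqdist_def)
  qed
  have lip: "vnorm Y (T u \<ominus>\<^bsub>Y\<^esub> T v) \<le> C * vnorm rkhs (q u \<ominus>\<^bsub>rkhs\<^esub> q v)" if "u \<in> ?P" "v \<in> ?P" for u v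
  proof (rule power2_le_imp_le)
    show "(vnorm Y (T u \<ominus>\<^bsub>Y\<^esub> T v))\<^sup>2 \<le> (C * vnorm rkhs (q u \<ominus>\<^bsub>rkhs\<^esub> q v))\<^sup>2"
      using dom[OF that] by (simp add: power_mult_distrib dist)
    show "0 \<le> C * vnorm rkhs (q u \<ominus>\<^bsub>rkhs\<^esub> q v)"
      by (intro mult_nonneg_nonneg C H.vnorm_nonneg H.M.minus_closed kernel_in_rkhs)
  qed
  \<comment> \<open>\<open>B\<close> picks an arbitrary preimage. The choice is harmless: tuples
    with the same kernel function are at distance 0, so the Lipschitz estimate forces equal values
    of \<open>T\<close>.\<close>
  have B: "B (q u) = T u" if u: "u \<in> ?P" for u
  proof -
    define v where "v = (SOME v. v \<in> ?P \<and> q v = q u)"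
    have v: "v \<in> ?P" "q v = q u"
      using someI[of "\<lambda>v. v \<in> ?P \<and> q v = q u" u] u by (auto simp: v_def)
    have "q v \<ominus>\<^bsub>rkhs\<^esub> q u = \<zero>\<^bsub>rkhs\<^esub>"
      using v H.minus_eq_zero_iff[OF kernel_in_rkhs kernel_in_rkhs] by metis
    then have "vnorm Y (T v \<ominus>\<^bsub>Y\<^esub> T u) \<le> 0"
      using lip[OF v(1) u] H.vnorm_zero by (simp only: mult_zero_right)
    then have "vnorm Y (T v \<ominus>\<^bsub>Y\<^esub> T u) = 0"
      using Y.vnorm_nonneg[of "T v \<ominus>\<^bsub>Y\<^esub> T u"] TY v u by simp
    then have "T v = T u"
      using Y.vnorm_eq_0_iff[of "T v \<ominus>\<^bsub>Y\<^esub> T u"] Y.minus_eq_zero_iff[of "T v" "T u"] TY v u by simp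
    then show ?thesis by (simp add: B_def v_def)
  qed
  have norm_q: "vnorm rkhs (q u) \<le> 1" if u: "u \<in> unit_tuples n X" for u
  proof (rule power2_le_imp_le)
    \<comment> \<open>The squared norm of \<open>q u\<close> is the diagonal value
      \<open>q u u\<close>, which the defining bound of \<open>kernels\<close> controls on unit
      tuples.\<close>
    have "complex_of_real ((vnorm rkhs (q u))\<^sup>2) = q u u"
      using H.ip_norm[OF kernel_in_rkhs, of u] by (simp only: rkhs_ip_kernel)
    then have "(vnorm rkhs (q u))\<^sup>2 = Re (q u u)" by (metis Re_complex_of_real)
    also have "\<dots> \<le> norm_prod n X u * norm_prod n X u"
      using complex_Re_le_cmod kernelsD(1)[OF q] by (rule order_trans)
    also have "\<dots> \<le> 1"
      using norm_prod_le_1[OF X u] norm_prod_nonneg[OF X] by (intro mult_le_one) auto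
    finally show "(vnorm rkhs (q u))\<^sup>2 \<le> 1\<^sup>2" by simp
  qed simp
  \<comment> \<open>Operations in \<open>rkhs\<close> are pointwise, so multilinearity of all
    \<open>\<lambda>s. q s t\<close> is multilinearity of \<open>q\<close> as a map into
    functions.\<close>
  have mq: "multilinear K n X rkhs q"
    unfolding multilinear_def
  proof (intro conjI ballI allI impI)
    show "q \<in> ?P \<rightarrow> carrier rkhs" using kernel_in_rkhs by blast
  qed (use kernelsD(5)[OF q] in \<open>auto simp: multilinear_def scalars_simps fun_eq_iff\<close>)
  have lb: "lip_bound rkhs (q ` ?P) Y B C"
    unfolding lip_bound_def using C lip B by auto
  have "hilbert_factorization K n X Y T rkhs (q ` ?P) q B"
    unfolding hilbert_factorization_def bounded_multilinear_def
  proof (intro conjI ballI)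
    show "hilbert_space K rkhs" by (rule rkhs_hilbert_space)
    show "q ` ?P \<subseteq> carrier rkhs" using kernel_in_rkhs by blast
    show "bdd_above ((\<lambda>u. vnorm rkhs (q u)) ` unit_tuples n X)"
      by (rule bdd_aboveI2[OF norm_q])
    show "B \<in> q ` ?P \<rightarrow> carrier Y" using B TY by auto
  qed (use mq lb B in auto)
  moreover have "mnorm n X rkhs q \<le> 1"
    unfolding mnorm_def
  proof (rule cSUP_least[OF _ norm_q])
    show "unit_tuples n X \<noteq> {}" by (rule unit_tuples_nonempty[OF X])
  qed
  ultimately show thesis using lb by (rule that)
qed

theorem mainTheorem4:
  fixes K :: "complex set" and n :: nat
    and X :: "nat \<Rightarrow> 'a nspace" and Y :: "'b nspace"
    and T :: "(nat \<Rightarrow> 'a) \<Rightarrow> 'b"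
  assumes "K = \<real> \<or> K = UNIV"
    and "1 \<le> n"
    and "\<And>i. i < n \<Longrightarrow> banach_space K (X i)"
    and "banach_space K Y"
    and "lip2_summing K n X Y T"
  shows "factors_through_hilbert K n X Y T \<and> Gamma_norm K n X Y T \<le> pi2_lip K n X Y T"
proof -
  let ?C = "pi2_lip K n X Y T"
  have X: "normed_space K (X i)" if "i < n" for i
    using assms(3)[OF that] by (simp add: banach_space_def)
  have Y: "normed_space K Y" using assms(4) by (simp add: banach_space_def)
  have T: "multilinear K n X Y T"
    using assms(5) by (simp add: lip2_summing_def bounded_multilinear_def)
  have C: "lip2_bound K n X Y T ?C" by (rule pi2_lip_is_least(1)[OF assms(5)])
  then have C0: "0 \<le> ?C" by (simp add: lip2_bound_def)
  obtain q where q: "q \<in> kernels K n X"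
    "\<And>u v. u \<in> tuples n X \<Longrightarrow> v \<in> tuples n X \<Longrightarrow>
      (vnorm Y (T u \<ominus>\<^bsub>Y\<^esub> T v))\<^sup>2 \<le> ?C\<^sup>2 * kernel_sqdist q u v"
    by (rule lip2_dominating_kernel[OF assms(1,2) X Y T C], assumption) (rule that)
  obtain H :: "((nat \<Rightarrow> 'a) \<Rightarrow> complex) ipspace" and M B
    where F: "hilbert_factorization K n X Y T H M q B" and A: "mnorm n X H q \<le> 1"
      and B: "lip_bound H M Y B ?C"
    by (rule hilbert_factorization_of_kernel[OF assms(1) X Y T C0 q], assumption, assumption, assumption) (rule that)
  have "Gamma_norm K n X Y T \<le> mnorm n X H q * lip_const H M Y B"
    by (rule Gamma_le[OF X F])
  also have "\<dots> \<le> 1 * lip_const H M Y B"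
    using B by (intro mult_right_mono A lip_const_nonneg) blast
  also have "lip_const H M Y B \<le> ?C"
    unfolding lip_const_def using B
    by (intro cInf_lower bdd_belowI[of _ 0]) (auto simp: lip_bound_def)
  finally have "Gamma_norm K n X Y T \<le> ?C" by simp
  then show ?thesis using factors_through_hilbertI[OF X T F] by blast
qed

end
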